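(* Let $\mathcal{A}$ be a bicomplete, locally small abelian category, let $\tau:T\hookrightarrow1_{\mathcal{A}}$ be any preradical of $\mathcal{A}$, and let $\mathbb{F}_\tau:=\{M\in\mathcal{A}\mid \tau_M=0\}$. Then $\tau$ is a radical if and only if $$\tau=\bigwedge_{M\in\mathbb{F}_\tau}\omega_{1_M}.$$
   Context: Bicomplete means complete and cocomplete; locally small means that the class of subobjects of each object is a set; Hom-classes are sets. A preradical of an abelian category $\mathcal{A}$ is a subobject of the identity functor $1_{\mathcal{A}}$ in the (possibly extended) abelian category $\mathrm{Fun}(\mathcal{A},\mathcal{A})$, i.e. the equivalence class of a monomorphic natural transformation $\tau:T\hookrightarrow 1_{\mathcal{A}}$, two such being equivalent if each factors through the other; $\tau_M:T(M)\to M$ is its component at $M$. $Pr(\mathcal{A})$ is the collection of preradicals, ordered by $\tau\leq\sigma$ iff $\tau$ factors through $\sigma$; under the stated hypotheses on $\mathcal{A}$ every collection of preradicals (not necessarily a set) has a join $\bigvee$ and a meet $\bigwedge$. For $\sigma:S\hookrightarrow 1_{\mathcal{A}}$, $\sigma^*:1_{\mathcal{A}}\twoheadrightarrow S^*$ denotes its cokernel. For preradicals $\tau:T\hookrightarrow1_{\mathcal{A}}$ and $\sigma:S\hookrightarrow1_{\mathcal{A}}$, the coproduct $(\sigma:\tau)$ is the preradical represented by the pullback of $\tau S^*:TS^*\hookrightarrow S^*$ along $\sigma^*:1_{\mathcal{A}}\to S^*$; $\sigma$ is a radical if $(\sigma:\sigma)=\sigma$. Omega preradicals: for objects $N,M$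 of $\mathcal{A}$, $\mathbb{W}_M^N:\mathcal{A}\to\mathcal{A}$ is the functor $L\mapsto M^{\mathrm{Hom}_{\mathcal{A}}(L,N)}$ (product of copies of $M$ indexed by $\mathrm{Hom}_{\mathcal{A}}(L,N)$, with projections $\pi_f$), the composite of the contravariant functors $\mathrm{Hom}_{\mathcal{A}}(-,N)$ and $M^{-}$. For a morphism $k:N\to M$, $\mathbf{W}_k:1_{\mathcal{A}}\to\mathbb{W}_M^N$ is the natural transformation determined by $\pi_f\circ[\mathbf{W}_k]_L=k\circ f$ for all $L$ and all $f\in\mathrm{Hom}_{\mathcal{A}}(L,N)$. The omega preradical associated to $k$ is $\omega_k:=\mathrm{Ker}(\mathbf{W}_k)$; here $1_M$ is the identity morphism of $M$. *)

theory Defs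
  imports "HOL-Algebra.Lattice" "HOL-Library.Equipollence"
begin

section \<open>Sets and classes\<close>

text \<open>
  The distinction between sets and classes is made relative to a universe, given by a type
  \<open>'u\<close> whose cardinality is an infinite regular strong limit: a collection (of elements of
  any type) is a set iff it has fewer elements than \<open>'u\<close>. The collection of all elements of
  \<open>'u\<close> plays the role of the class of all sets. Uncountability of \<open>'u\<close> is not imposed; the
  uncountable case is that of a Grothendieck universe (strongly inaccessible cardinality).
\<close>

definition small :: "'u itself \<Rightarrow> 'x set \<Rightarrow> bool" where
  "small U A \<longleftrightarrow> A \<prec> (UNIV :: 'u set)"

definition universe :: "'u itself \<Rightarrow> bool" where
  "universe U \<longleftrightarrow> infinite (UNIV :: 'u set)
     \<and> (\<forall>A :: 'u set. small U A \<longrightarrow> small U (Pow A))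
     \<and> (\<forall>(A :: 'u set) (B :: 'u \<Rightarrow> 'u set).
          small U A \<and> (\<forall>a\<in>A. small U (B a)) \<longrightarrow> small U (\<Union>a\<in>A. B a))"


section \<open>Categories\<close>

record ('o, 'a) cat =
  Ob :: "'o set"
  Arr :: "'a set"
  Dom :: "'a \<Rightarrow> 'o"
  Cod :: "'a \<Rightarrow> 'o"
  Idt :: "'o \<Rightarrow> 'a"
  Comp :: "'a \<Rightarrow> 'a \<Rightarrow> 'a" (infixl \<open>\<cdot>\<index>\<close> 70)

definition Hom :: "('o, 'a) cat \<Rightarrow> 'o \<Rightarrow> 'o \<Rightarrow> 'a set" where
  "Hom C X Y = {f \<in> Arr C. Dom C f = X \<and> Cod C f = Y}"

locale category =
  fixes C :: "('o, 'a) cat" (structure)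
  assumes Dom_Ob: "f \<in> Arr C \<Longrightarrow> Dom C f \<in> Ob C"
    and Cod_Ob: "f \<in> Arr C \<Longrightarrow> Cod C f \<in> Ob C"
    and Idt_Hom: "X \<in> Ob C \<Longrightarrow> Idt C X \<in> Hom C X X"
    and Comp_Hom: "\<lbrakk>f \<in> Hom C X Y; g \<in> Hom C Y Z\<rbrakk> \<Longrightarrow> g \<cdot> f \<in> Hom C X Z"
    and Idt_left: "f \<in> Hom C X Y \<Longrightarrow> Idt C Y \<cdot> f = f"
    and Idt_right: "f \<in> Hom C X Y \<Longrightarrow> f \<cdot> Idt C X = f"
    and Comp_assoc: "\<lbrakk>f \<in> Hom C W X; g \<in> Hom C X Y; h \<in> Hom C Y Z\<rbrakk>
           \<Longrightarrow> (h \<cdot> g) \<cdot> f = h \<cdot> (g \<cdot> f)"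

definition op_cat :: "('o, 'a) cat \<Rightarrow> ('o, 'a) cat" where
  "op_cat C = \<lparr>Ob = Ob C, Arr = Arr C, Dom = Cod C, Cod = Dom C, Idt = Idt C,
               Comp = (\<lambda>g f. f \<cdot>\<^bsub>C\<^esub> g)\<rparr>"

definition is_mono :: "('o, 'a) cat \<Rightarrow> 'a \<Rightarrow> bool" where
  "is_mono C m \<longleftrightarrow> m \<in> Arr C \<and>
     (\<forall>X. \<forall>f\<in>Hom C X (Dom C m). \<forall>g\<in>Hom C X (Dom C m). m \<cdot>\<^bsub>C\<^esub> f = m \<cdot>\<^bsub>C\<^esub> g \<longrightarrow> f = g)"

definition is_epi :: "('o, 'a) cat \<Rightarrow> 'a \<Rightarrow> bool" where
  "is_epi C = is_mono (op_cat C)"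

definition is_zero_object :: "('o, 'a) cat \<Rightarrow> 'o \<Rightarrow> bool" where
  "is_zero_object C Z \<longleftrightarrow> Z \<in> Ob C \<and>
     (\<forall>X\<in>Ob C. (\<exists>!f. f \<in> Hom C X Z) \<and> (\<exists>!f. f \<in> Hom C Z X))"

definition is_zero_arrow :: "('o, 'a) cat \<Rightarrow> 'a \<Rightarrow> bool" where
  "is_zero_arrow C f \<longleftrightarrow> f \<in> Arr C \<and>
     (\<exists>Z. is_zero_object C Z \<and>
       (\<exists>g\<in>Hom C (Dom C f) Z. \<exists>h\<in>Hom C Z (Cod C f). f = h \<cdot>\<^bsub>C\<^esub> g))"

definition is_kernel :: "('o, 'a) cat \<Rightarrow> 'a \<Rightarrow> 'a \<Rightarrow> bool" where
  "is_kernel C f k \<longleftrightarrow> f \<in> Arr C \<and> k \<in> Arr C \<and> Cod C k = Dom C f \<and> is_zero_arrow C (f \<cdot>\<^bsub>C\<^esub> k) \<and>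
     (\<forall>X. \<forall>h\<in>Hom C X (Dom C f). is_zero_arrow C (f \<cdot>\<^bsub>C\<^esub> h) \<longrightarrow>
       (\<exists>!u. u \<in> Hom C X (Dom C k) \<and> k \<cdot>\<^bsub>C\<^esub> u = h))"

definition is_cokernel :: "('o, 'a) cat \<Rightarrow> 'a \<Rightarrow> 'a \<Rightarrow> bool" where
  "is_cokernel C = is_kernel (op_cat C)"

definition is_product ::
    "('o, 'a) cat \<Rightarrow> 'i set \<Rightarrow> ('i \<Rightarrow> 'o) \<Rightarrow> 'o \<Rightarrow> ('i \<Rightarrow> 'a) \<Rightarrow> bool" where
  "is_product C I X P p \<longleftrightarrow> P \<in> Ob C \<and> (\<forall>i\<in>I. p i \<in> Hom C P (X i)) \<and>
     (\<forall>Y\<in>Ob C. \<forall>f. (\<forall>i\<in>I. f i \<in> Hom C Y (X i)) \<longrightarrow>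
       (\<exists>!u. u \<in> Hom C Y P \<and> (\<forall>i\<in>I. p i \<cdot>\<^bsub>C\<^esub> u = f i)))"

text \<open>Argument order: the square is \<open>f \<cdot> p = g \<cdot> q\<close>.\<close>

definition is_pullback :: "('o, 'a) cat \<Rightarrow> 'a \<Rightarrow> 'a \<Rightarrow> 'a \<Rightarrow> 'a \<Rightarrow> bool" where
  "is_pullback C f g p q \<longleftrightarrow>
     f \<in> Arr C \<and> g \<in> Arr C \<and> p \<in> Arr C \<and> q \<in> Arr C \<and> Cod C f = Cod C g \<and> Dom C p = Dom C q \<and>
     Cod C p = Dom C f \<and> Cod C q = Dom C g \<and> f \<cdot>\<^bsub>C\<^esub> p = g \<cdot>\<^bsub>C\<^esub> q \<and>
     (\<forall>X. \<forall>a\<in>Hom C X (Dom C f). \<forall>b\<in>Hom C X (Dom C g). f \<cdot>\<^bsub>C\<^esub> a = g \<cdot>\<^bsub>C\<^esub> b \<longrightarrow>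
       (\<exists>!u. u \<in> Hom C X (Dom C p) \<and> p \<cdot>\<^bsub>C\<^esub> u = a \<and> q \<cdot>\<^bsub>C\<^esub> u = b))"


section \<open>Subobjects\<close>

definition monos_into :: "('o, 'a) cat \<Rightarrow> 'o \<Rightarrow> 'a set" where
  "monos_into C X = {m. is_mono C m \<and> Cod C m = X}"

definition factors :: "('o, 'a) cat \<Rightarrow> 'a \<Rightarrow> 'a \<Rightarrow> bool" where
  "factors C m n \<longleftrightarrow> (\<exists>u\<in>Hom C (Dom C m) (Dom C n). m = n \<cdot>\<^bsub>C\<^esub> u)"

definition sub_rel :: "('o, 'a) cat \<Rightarrow> 'o \<Rightarrow> ('a \<times> 'a) set" where
  "sub_rel C X = {(m, n). m \<in> monos_into C X \<and> n \<in> monos_into C X \<and> factors C m n \<and> factors C n m}"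

definition sub_class :: "('o, 'a) cat \<Rightarrow> 'o \<Rightarrow> 'a \<Rightarrow> 'a set" where
  "sub_class C X m = sub_rel C X `` {m}"

definition subobjects :: "('o, 'a) cat \<Rightarrow> 'o \<Rightarrow> 'a set set" where
  "subobjects C X = monos_into C X // sub_rel C X"

definition subobject_order :: "('o, 'a) cat \<Rightarrow> 'o \<Rightarrow> 'a set gorder" where
  "subobject_order C X =
     \<lparr>carrier = subobjects C X, eq = (=), le = (\<lambda>A B. \<exists>m\<in>A. \<exists>n\<in>B. factors C m n)\<rparr>"


section \<open>Functors and natural transformations\<close>

text \<open>
  The maps of functors and the components of natural transformations are extensional
  functions, so that functors and natural transformations are determined by their values on
  objects and arrows of the source category.
\<close>

datatype ('o, 'a, 'p, 'b) functr = Functr (omap: "'o \<Rightarrow> 'p") (amap: "'a \<Rightarrow> 'b")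

datatype ('o, 'a, 'p, 'b) nattr =
  Nattr (nsrc: "('o, 'a, 'p, 'b) functr") (ntgt: "('o, 'a, 'p, 'b) functr") (ncomp: "'o \<Rightarrow> 'b")

definition is_functor ::
    "('o, 'a) cat \<Rightarrow> ('p, 'b) cat \<Rightarrow> ('o, 'a, 'p, 'b) functr \<Rightarrow> bool" where
  "is_functor C D F \<longleftrightarrow> omap F \<in> extensional (Ob C) \<and> amap F \<in> extensional (Arr C) \<and>
     (\<forall>X\<in>Ob C. omap F X \<in> Ob D \<and> amap F (Idt C X) = Idt D (omap F X)) \<and>
     (\<forall>f\<in>Arr C. amap F f \<in> Hom D (omap F (Dom C f)) (omap F (Cod C f))) \<and>
     (\<forall>f\<in>Arr C. \<forall>g\<in>Arr C. Dom C g = Cod C f \<longrightarrow>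
        amap F (g \<cdot>\<^bsub>C\<^esub> f) = amap F g \<cdot>\<^bsub>D\<^esub> amap F f)"

definition is_nattrans ::
    "('o, 'a) cat \<Rightarrow> ('p, 'b) cat \<Rightarrow> ('o, 'a, 'p, 'b) nattr \<Rightarrow> bool" where
  "is_nattrans C D t \<longleftrightarrow> is_functor C D (nsrc t) \<and> is_functor C D (ntgt t) \<and>
     ncomp t \<in> extensional (Ob C) \<and>
     (\<forall>X\<in>Ob C. ncomp t X \<in> Hom D (omap (nsrc t) X) (omap (ntgt t) X)) \<and>
     (\<forall>f\<in>Arr C. amap (ntgt t) f \<cdot>\<^bsub>D\<^esub> ncomp t (Dom C f) = ncomp t (Cod C f) \<cdot>\<^bsub>D\<^esub> amap (nsrc t) f)"

definition id_functor :: "('o, 'a) cat \<Rightarrow> ('o, 'a, 'o, 'a) functr" where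
  "id_functor C = Functr (\<lambda>X\<in>Ob C. X) (\<lambda>f\<in>Arr C. f)"

definition comp_functor :: "('o, 'a) cat \<Rightarrow> ('p, 'b, 'q, 'c) functr \<Rightarrow> ('o, 'a, 'p, 'b) functr \<Rightarrow>
    ('o, 'a, 'q, 'c) functr" where
  "comp_functor C G F = Functr (compose (Ob C) (omap G) (omap F)) (compose (Arr C) (amap G) (amap F))"

definition Fun :: "('o, 'a) cat \<Rightarrow> ('p, 'b) cat \<Rightarrow>
    (('o, 'a, 'p, 'b) functr, ('o, 'a, 'p, 'b) nattr) cat" where
  "Fun C D = \<lparr>Ob = {F. is_functor C D F}, Arr = {t. is_nattrans C D t}, Dom = nsrc, Cod = ntgt,
     Idt = (\<lambda>F. Nattr F F (\<lambda>X\<in>Ob C. Idt D (omap F X))),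
     Comp = (\<lambda>t s. Nattr (nsrc s) (ntgt t) (\<lambda>X\<in>Ob C. ncomp t X \<cdot>\<^bsub>D\<^esub> ncomp s X))\<rparr>"

text \<open>Whiskering \<open>tS\<close> of a natural transformation \<open>t\<close> with a functor \<open>S\<close> out of \<open>C\<close>.\<close>

definition whisker :: "('o, 'a) cat \<Rightarrow> ('p, 'b, 'q, 'c) nattr \<Rightarrow> ('o, 'a, 'p, 'b) functr \<Rightarrow>
    ('o, 'a, 'q, 'c) nattr" where
  "whisker C t S = Nattr (comp_functor C (nsrc t) S) (comp_functor C (ntgt t) S)
     (compose (Ob C) (ncomp t) (omap S))"


section \<open>Bicomplete, locally small, abelian\<close>

definition is_cone :: "('i, 'j) cat \<Rightarrow> ('o, 'a) cat \<Rightarrow> ('i, 'j, 'o, 'a) functr \<Rightarrow> 'o \<Rightarrow> ('i \<Rightarrow> 'a) \<Rightarrow> bool"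
  where
  "is_cone J C F X c \<longleftrightarrow> X \<in> Ob C \<and> (\<forall>i\<in>Ob J. c i \<in> Hom C X (omap F i)) \<and>
     (\<forall>u\<in>Arr J. amap F u \<cdot>\<^bsub>C\<^esub> c (Dom J u) = c (Cod J u))"

definition is_limit :: "('i, 'j) cat \<Rightarrow> ('o, 'a) cat \<Rightarrow> ('i, 'j, 'o, 'a) functr \<Rightarrow> 'o \<Rightarrow> ('i \<Rightarrow> 'a) \<Rightarrow> bool"
  where
  "is_limit J C F L l \<longleftrightarrow> is_cone J C F L l \<and>
     (\<forall>X c. is_cone J C F X c \<longrightarrow>
       (\<exists>!u. u \<in> Hom C X L \<and> (\<forall>i\<in>Ob J. l i \<cdot>\<^bsub>C\<^esub> u = c i)))"

text \<open>
  Every small category is isomorphic to one whose objects and arrows are elements of \<open>'u\<close>,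
  so it is enough to consider diagrams of such shapes.
\<close>

definition complete :: "'u itself \<Rightarrow> ('o, 'a) cat \<Rightarrow> bool" where
  "complete U C \<longleftrightarrow>
     (\<forall>J :: ('u, 'u) cat. category J \<and> small U (Ob J) \<and> small U (Arr J) \<longrightarrow>
       (\<forall>F. is_functor J C F \<longrightarrow> (\<exists>L l. is_limit J C F L l)))"

definition bicomplete :: "'u itself \<Rightarrow> ('o, 'a) cat \<Rightarrow> bool" where
  "bicomplete U C \<longleftrightarrow> complete U C \<and> complete U (op_cat C)"

definition hom_small :: "'u itself \<Rightarrow> ('o, 'a) cat \<Rightarrow> bool" where
  "hom_small U C \<longleftrightarrow> (\<forall>X\<in>Ob C. \<forall>Y\<in>Ob C. small U (Hom C X Y))"

definition locally_small :: "'u itself \<Rightarrow> ('o, 'a) cat \<Rightarrow> bool" where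
  "locally_small U C \<longleftrightarrow> (\<forall>X\<in>Ob C. small U (subobjects C X))"

text \<open>
  Abelian categories in the sense of Freyd and Borceux; the additive structure is determined
  by these data.
\<close>

locale abelian_category = category +
  assumes zero_object: "\<exists>Z. is_zero_object C Z"
    and binary_products: "\<lbrakk>X \<in> Ob C; Y \<in> Ob C\<rbrakk>
           \<Longrightarrow> \<exists>P p. is_product C (UNIV :: bool set) (\<lambda>b. if b then X else Y) P p"
    and binary_coproducts: "\<lbrakk>X \<in> Ob C; Y \<in> Ob C\<rbrakk>
           \<Longrightarrow> \<exists>P p. is_product (op_cat C) (UNIV :: bool set) (\<lambda>b. if b then X else Y) P p"
    and kernels: "f \<in> Arr C \<Longrightarrow> \<exists>k. is_kernel C f k"
    and cokernels: "f \<in> Arr C \<Longrightarrow> \<exists>q. is_cokernel C f q"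
    and mono_is_kernel: "is_mono C m \<Longrightarrow> \<exists>f. is_kernel C f m"
    and epi_is_cokernel: "is_epi C e \<Longrightarrow> \<exists>f. is_cokernel C f e"


section \<open>Preradicals\<close>

abbreviation End :: "('o, 'a) cat \<Rightarrow> (('o, 'a, 'o, 'a) functr, ('o, 'a, 'o, 'a) nattr) cat" where
  "End C \<equiv> Fun C C"

text \<open>
  Preradicals are classes of monomorphisms of \<open>End C\<close> into the identity functor. Constructions
  below are given on representatives; \<open>pr_class\<close> is the preradical that is represented.
\<close>

definition Pr :: "('o, 'a) cat \<Rightarrow> ('o, 'a, 'o, 'a) nattr set gorder" where
  "Pr C = subobject_order (End C) (id_functor C)"

definition pr_class :: "('o, 'a) cat \<Rightarrow> ('o, 'a, 'o, 'a) nattr \<Rightarrow> ('o, 'a, 'o, 'a) nattr set" where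
  "pr_class C t = sub_class (End C) (id_functor C) t"

definition coker_pr :: "('o, 'a) cat \<Rightarrow> ('o, 'a, 'o, 'a) nattr \<Rightarrow> ('o, 'a, 'o, 'a) nattr" where
  "coker_pr C s = (SOME q. is_cokernel (End C) s q)"

definition coprod_pr ::
    "('o, 'a) cat \<Rightarrow> ('o, 'a, 'o, 'a) nattr \<Rightarrow> ('o, 'a, 'o, 'a) nattr \<Rightarrow> ('o, 'a, 'o, 'a) nattr" where
  "coprod_pr C s t = (SOME p. \<exists>q.
     is_pullback (End C) (coker_pr C s) (whisker C t (ntgt (coker_pr C s))) p q)"

definition radical :: "('o, 'a) cat \<Rightarrow> ('o, 'a, 'o, 'a) nattr \<Rightarrow> bool" where
  "radical C s \<longleftrightarrow> pr_class C (coprod_pr C s s) = pr_class C s"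

definition torsion_free :: "('o, 'a) cat \<Rightarrow> ('o, 'a, 'o, 'a) nattr \<Rightarrow> 'o set" (\<open>\<F>\<close>) where
  "\<F> C t = {M \<in> Ob C. is_zero_arrow C (ncomp t M)}"


section \<open>Omega preradicals\<close>

definition pow :: "('o, 'a) cat \<Rightarrow> 'o \<Rightarrow> 'i set \<Rightarrow> 'o \<times> ('i \<Rightarrow> 'a)" where
  "pow C M I = (SOME P. is_product C I (\<lambda>_. M) (fst P) (snd P))"

abbreviation pow_ob :: "('o, 'a) cat \<Rightarrow> 'o \<Rightarrow> 'i set \<Rightarrow> 'o" where
  "pow_ob C M I \<equiv> fst (pow C M I)"

abbreviation pow_proj :: "('o, 'a) cat \<Rightarrow> 'o \<Rightarrow> 'i set \<Rightarrow> 'i \<Rightarrow> 'a" where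
  "pow_proj C M I \<equiv> snd (pow C M I)"

text \<open>The arrow \<open>M\<^sup>\<phi> : M\<^sup>J \<rightarrow> M\<^sup>I\<close> induced by a map \<open>\<phi> : I \<rightarrow> J\<close>.\<close>

definition pow_map :: "('o, 'a) cat \<Rightarrow> 'o \<Rightarrow> 'i set \<Rightarrow> 'j set \<Rightarrow> ('i \<Rightarrow> 'j) \<Rightarrow> 'a" where
  "pow_map C M I J \<phi> = (THE h. h \<in> Hom C (pow_ob C M J) (pow_ob C M I) \<and>
     (\<forall>i\<in>I. pow_proj C M I i \<cdot>\<^bsub>C\<^esub> h = pow_proj C M J (\<phi> i)))"

definition W_functor :: "('o, 'a) cat \<Rightarrow> 'o \<Rightarrow> 'o \<Rightarrow> ('o, 'a, 'o, 'a) functr" where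
  "W_functor C N M = Functr
     (\<lambda>L\<in>Ob C. pow_ob C M (Hom C L N))
     (\<lambda>g\<in>Arr C. pow_map C M (Hom C (Cod C g) N) (Hom C (Dom C g) N) (\<lambda>f. f \<cdot>\<^bsub>C\<^esub> g))"

definition W_nat :: "('o, 'a) cat \<Rightarrow> 'a \<Rightarrow> ('o, 'a, 'o, 'a) nattr" where
  "W_nat C k = Nattr (id_functor C) (W_functor C (Dom C k) (Cod C k))
     (\<lambda>L\<in>Ob C. THE h. h \<in> Hom C L (pow_ob C (Cod C k) (Hom C L (Dom C k))) \<and>
        (\<forall>f\<in>Hom C L (Dom C k). pow_proj C (Cod C k) (Hom C L (Dom C k)) f \<cdot>\<^bsub>C\<^esub> h = k \<cdot>\<^bsub>C\<^esub> f))"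

definition omega :: "('o, 'a) cat \<Rightarrow> 'a \<Rightarrow> ('o, 'a, 'o, 'a) nattr" where
  "omega C k = (SOME w. is_kernel (End C) (W_nat C k) w)"

end

theory Submission
  imports Defs
begin

text \<open>
  By naturality a preradical \<open>s\<close> lies below \<open>\<omega>\<close> of the identity of \<open>M\<close> iff it vanishes at \<open>M\<close>.
  Hence the meet in question is the largest preradical \<open>r\<close> that vanishes on \<open>\<F> C t\<close>, and \<open>t \<le> r\<close>.
  If \<open>t\<close> is a radical, then \<open>t\<close>, and therefore \<open>r\<close>, vanishes at each quotient of an object \<open>X\<close> by
  its \<open>t\<close>-part, so that \<open>r\<close> at \<open>X\<close> is contained in the kernel \<open>t\<close> of the projection. Conversely
  \<open>(t : t)\<close> vanishes wherever \<open>t\<close> does, so \<open>t = r\<close> implies \<open>(t : t) \<le> t\<close>.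
\<close>

section \<open>Kernels and zero arrows\<close>

text \<open>Every notion involved is a statement about \<open>End C\<close>, which is never shown to
  be abelian: it is given a zero object, and kernels and cokernels computed componentwise; whatever
  else is needed is checked on components in \<open>C\<close>. The delicate point is that a
  monomorphism of \<open>End C\<close> has monic components. This rests on the fact that an arrow of
  an abelian category with zero kernel is monic, and as the axioms contain no addition of arrows,
  that fact has to come from equalizers instead of subtraction.

  Cokernels, pullbacks, omega preradicals and the infimum are choices made by \<open>SOME\<close>,
  so each is first shown to exist and is then used only through its universal property. A kernel is
  handled through the equivalence that \<open>h\<close> factors through it iff composing with
  \<open>h\<close> gives zero; inequalities between preradicals thereby become statements that
  certain arrows vanish.

  The meet runs over a possibly proper class of objects, so that no single product over it is at
  hand. Local smallness repairs this at each object: only the subobjects that occur as kernels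
  matter, and they form a set.\<close>

lemma op_cat_simps [simp]:
  "Ob (op_cat C) = Ob C" "Arr (op_cat C) = Arr C" "Dom (op_cat C) = Cod C"
  "Cod (op_cat C) = Dom C" "Idt (op_cat C) = Idt C" "g \<cdot>\<^bsub>op_cat C\<^esub> f = f \<cdot>\<^bsub>C\<^esub> g"
  by (simp_all add: op_cat_def)

lemma op_op_cat [simp]: "op_cat (op_cat C) = C"
  by (simp add: op_cat_def)

lemma Hom_op_cat [simp]: "Hom (op_cat C) X Y = Hom C Y X"
  by (auto simp: Hom_def)

lemma is_zero_object_op_cat [simp]: "is_zero_object (op_cat C) Z \<longleftrightarrow> is_zero_object C Z"
  by (auto simp: is_zero_object_def)

lemma is_zero_arrow_op_cat [simp]: "is_zero_arrow (op_cat C) f \<longleftrightarrow> is_zero_arrow C f"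
  by (auto simp: is_zero_arrow_def)

lemma factors_iff:
  "factors C m n \<longleftrightarrow> (\<exists>u\<in>Arr C. Dom C u = Dom C m \<and> Cod C u = Dom C n \<and> n \<cdot>\<^bsub>C\<^esub> u = m)"
  by (auto simp: factors_def Hom_def)

lemma is_zero_arrow_Arr: "is_zero_arrow C f \<Longrightarrow> f \<in> Arr C"
  by (simp add: is_zero_arrow_def)

lemma is_mono_Arr: "is_mono C m \<Longrightarrow> m \<in> Arr C"
  by (simp add: is_mono_def)

lemma is_mono_cancel:
  "\<lbrakk>is_mono C m; f \<in> Arr C; g \<in> Arr C; Cod C f = Dom C m; Cod C g = Dom C m; Dom C f = Dom C g;
    m \<cdot>\<^bsub>C\<^esub> f = m \<cdot>\<^bsub>C\<^esub> g\<rbrakk> \<Longrightarrow> f = g"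
  by (auto simp: is_mono_def Hom_def)

lemma is_monoI:
  "\<lbrakk>m \<in> Arr C; \<And>f g. \<lbrakk>f \<in> Arr C; g \<in> Arr C; Cod C f = Dom C m; Cod C g = Dom C m;
      Dom C f = Dom C g; m \<cdot>\<^bsub>C\<^esub> f = m \<cdot>\<^bsub>C\<^esub> g\<rbrakk> \<Longrightarrow> f = g\<rbrakk> \<Longrightarrow> is_mono C m"
  by (auto simp: is_mono_def Hom_def)

context category
begin

lemma Dom_in_Ob [simp]: "f \<in> Arr C \<Longrightarrow> Dom C f \<in> Ob C"
  and Cod_in_Ob [simp]: "f \<in> Arr C \<Longrightarrow> Cod C f \<in> Ob C"
  by (fact Dom_Ob, fact Cod_Ob)

lemma Idt_simps [simp]:
  assumes "X \<in> Ob C"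
  shows "Idt C X \<in> Arr C" "Dom C (Idt C X) = X" "Cod C (Idt C X) = X"
  using Idt_Hom[OF assms] by (auto simp: Hom_def)

lemma Comp_simps [simp]:
  assumes "f \<in> Arr C" "g \<in> Arr C" "Dom C g = Cod C f"
  shows "g \<cdot> f \<in> Arr C" "Dom C (g \<cdot> f) = Dom C f" "Cod C (g \<cdot> f) = Cod C g"
  using Comp_Hom[of f "Dom C f" "Cod C f" g "Cod C g"] assms by (auto simp: Hom_def)

lemma Comp_Idt [simp]:
  assumes "f \<in> Arr C"
  shows "Y = Cod C f \<Longrightarrow> Idt C Y \<cdot> f = f" "X = Dom C f \<Longrightarrow> f \<cdot> Idt C X = f"
  using Idt_left[of f "Dom C f" "Cod C f"] Idt_right[of f "Dom C f" "Cod C f"] assms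
  by (auto simp: Hom_def)

lemma Comp_Comp [simp]:
  assumes "f \<in> Arr C" "g \<in> Arr C" "h \<in> Arr C" "Dom C g = Cod C f" "Dom C h = Cod C g"
  shows "(h \<cdot> g) \<cdot> f = h \<cdot> (g \<cdot> f)"
  by (rule Comp_assoc[of f "Dom C f" "Cod C f" g "Cod C g" h "Cod C h"]) (use assms in \<open>auto simp: Hom_def\<close>)

lemma category_op_cat: "category (op_cat C)"
  by unfold_locales (auto simp: Hom_def)

lemma zero_arrow_comp_left:
  assumes "is_zero_arrow C f" "g \<in> Arr C" "Dom C g = Cod C f"
  shows "is_zero_arrow C (g \<cdot> f)"
proof -
  obtain Z a b where Z: "is_zero_object C Z" and ab: "a \<in> Hom C (Dom C f) Z" "b \<in> Hom C Z (Cod C f)"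
    and f: "f = b \<cdot> a"
    using assms(1) by (auto simp: is_zero_arrow_def)
  have fA: "f \<in> Arr C" using assms(1) by (rule is_zero_arrow_Arr)
  have g: "g \<in> Hom C (Cod C f) (Cod C g)" using assms by (simp add: Hom_def)
  have "g \<cdot> b \<in> Hom C Z (Cod C g)" "g \<cdot> f = (g \<cdot> b) \<cdot> a"
    using Comp_Hom[OF ab(2) g] Comp_assoc[OF ab g] f by simp_all
  moreover have "g \<cdot> f \<in> Arr C" "Dom C (g \<cdot> f) = Dom C f" "Cod C (g \<cdot> f) = Cod C g"
    using fA assms by auto
  ultimately show ?thesis using Z ab(1) unfolding is_zero_arrow_def by metis
qed

lemma zero_arrow_comp_right:
  assumes "is_zero_arrow C f" "g \<in> Arr C" "Cod C g = Dom C f"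
  shows "is_zero_arrow C (f \<cdot> g)"
  using category.zero_arrow_comp_left[OF category_op_cat, of f g] assms by simp

text \<open>The two arrows may pass through different zero objects; an arrow \<open>i\<close>
  between these turns one factorization into the other.\<close>

lemma zero_arrow_unique:
  assumes f: "is_zero_arrow C f" and g: "is_zero_arrow C g"
    and "Dom C f = Dom C g" "Cod C f = Cod C g"
  shows "f = g"
proof -
  obtain Z a b where Z: "is_zero_object C Z" and ab: "a \<in> Hom C (Dom C f) Z" "b \<in> Hom C Z (Cod C f)"
    and fe: "f = b \<cdot> a"
    using f by (auto simp: is_zero_arrow_def)
  obtain Z' a' b' where Z': "is_zero_object C Z'" and ab': "a' \<in> Hom C (Dom C f) Z'" "b' \<in> Hom C Z' (Cod C f)"
    and ge: "g = b' \<cdot> a'"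
    using g assms(3,4) by (auto simp: is_zero_arrow_def)
  obtain i where i: "i \<in> Hom C Z Z'"
    using Z Z' by (auto simp: is_zero_object_def)
  have Ob: "Dom C f \<in> Ob C" "Cod C f \<in> Ob C" using is_zero_arrow_Arr[OF f] by auto
  have "i \<cdot> a = a'"
    using Z' Ob(1) ab'(1) Comp_Hom[OF ab(1) i] unfolding is_zero_object_def by blast
  moreover have "b' \<cdot> i = b"
    using Z Ob(2) ab(2) Comp_Hom[OF i ab'(2)] unfolding is_zero_object_def by blast
  ultimately show ?thesis
    using ab ab' i fe ge Comp_assoc[OF ab(1) i ab'(2)] by simp
qed

lemma factors_compI: "\<lbrakk>n \<in> Arr C; u \<in> Arr C; Cod C u = Dom C n\<rbrakk> \<Longrightarrow> factors C (n \<cdot> u) n"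
  unfolding factors_iff by (intro bexI[of _ u]) auto

lemma factorsE:
  assumes "factors C m n"
  obtains u where "u \<in> Arr C" "Dom C u = Dom C m" "Cod C u = Dom C n" "n \<cdot> u = m"
  using assms by (auto simp: factors_iff)

lemma factors_comp:
  assumes "factors C l m" "m \<in> Arr C" "u \<in> Arr C" "Cod C u = Dom C l"
  shows "factors C (l \<cdot> u) m"
proof -
  obtain v where v: "v \<in> Arr C" "Dom C v = Dom C l" "Cod C v = Dom C m" "m \<cdot> v = l"
    using assms(1) by (rule factorsE)
  have "factors C (m \<cdot> (v \<cdot> u)) m"
    using assms v(1-3) by (intro factors_compI) simp_all
  moreover have "m \<cdot> (v \<cdot> u) = (m \<cdot> v) \<cdot> u"
    using assms v(1-3) by simp
  ultimately show ?thesis using v(4) by simp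
qed

lemma factors_trans:
  assumes "factors C l m" "factors C m n" "n \<in> Arr C"
  shows "factors C l n"
  using assms(1) factors_comp[OF assms(2,3)] by (metis factorsE)

lemma factors_refl: "m \<in> Arr C \<Longrightarrow> factors C m m"
  using factors_compI[of m "Idt C (Dom C m)"] by simp

text \<open>Monicity of \<open>k\<close> carries the uniqueness of the lifts, and the equivalence
  carries both their existence and the vanishing of \<open>f \<cdot> k\<close>. In this form
  subobjects are compared by asking which arrows factor through them.\<close>

lemma is_kernel_iff:
  "is_kernel C f k \<longleftrightarrow> f \<in> Arr C \<and> is_mono C k \<and> Cod C k = Dom C f \<and>
     (\<forall>h\<in>Arr C. Cod C h = Dom C f \<longrightarrow> factors C h k = is_zero_arrow C (f \<cdot> h))"
  (is "?L \<longleftrightarrow> ?R")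
proof
  assume L: ?L
  then have k: "f \<in> Arr C" "k \<in> Arr C" "Cod C k = Dom C f" "is_zero_arrow C (f \<cdot> k)"
    and u: "\<And>h. h \<in> Arr C \<Longrightarrow> Cod C h = Dom C f \<Longrightarrow> is_zero_arrow C (f \<cdot> h) \<Longrightarrow>
       \<exists>!u. u \<in> Hom C (Dom C h) (Dom C k) \<and> k \<cdot> u = h"
    unfolding is_kernel_def by (auto simp: Hom_def)
  have z: "is_zero_arrow C (f \<cdot> (k \<cdot> x))" if "x \<in> Arr C" "Cod C x = Dom C k" for x
    using zero_arrow_comp_right[OF k(4), of x] that k by simp
  have "is_mono C k"
  proof (rule is_monoI[OF k(2)])
    fix x y assume xy: "x \<in> Arr C" "y \<in> Arr C" "Cod C x = Dom C k" "Cod C y = Dom C k"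
      "Dom C x = Dom C y" "k \<cdot> x = k \<cdot> y"
    have "\<exists>!u. u \<in> Hom C (Dom C (k \<cdot> x)) (Dom C k) \<and> k \<cdot> u = k \<cdot> x"
      using u[of "k \<cdot> x"] z[of x] xy k by simp
    moreover have "x \<in> Hom C (Dom C (k \<cdot> x)) (Dom C k)" "y \<in> Hom C (Dom C (k \<cdot> x)) (Dom C k)"
      using xy k by (simp_all add: Hom_def del: xy(6))
    ultimately show "x = y" using xy(6) by metis
  qed
  moreover have "factors C h k = is_zero_arrow C (f \<cdot> h)" if h: "h \<in> Arr C" "Cod C h = Dom C f" for h
    using u[OF h] z by (auto simp: factors_iff Hom_def)
  ultimately show ?R using k by blast
next
  assume R: ?R
  then have k: "f \<in> Arr C" "k \<in> Arr C" "Cod C k = Dom C f" by (auto simp: is_mono_Arr)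
  have "is_zero_arrow C (f \<cdot> k)" using R k factors_refl by blast
  moreover have "\<exists>!u. u \<in> Hom C X (Dom C k) \<and> k \<cdot> u = h"
    if "h \<in> Hom C X (Dom C f)" "is_zero_arrow C (f \<cdot> h)" for X h
  proof -
    have h: "h \<in> Arr C" "Cod C h = Dom C f" "Dom C h = X" using that(1) by (auto simp: Hom_def)
    then have "factors C h k" using R that(2) by blast
    then obtain v where v: "v \<in> Hom C X (Dom C k)" "k \<cdot> v = h" using h by (auto simp: factors_iff Hom_def)
    moreover have "w = v" if "w \<in> Hom C X (Dom C k)" "k \<cdot> w = h" for w
      using R v that by (auto simp: Hom_def intro: is_mono_cancel[of C k])
    ultimately show ?thesis by blast
  qed
  ultimately show ?L using k by (simp add: is_kernel_def)
qed

lemma kernel_simps: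
  assumes "is_kernel C f k"
  shows "f \<in> Arr C" "k \<in> Arr C" "Cod C k = Dom C f" "is_mono C k" "is_zero_arrow C (f \<cdot> k)"
    "\<And>h. h \<in> Arr C \<Longrightarrow> Cod C h = Dom C f \<Longrightarrow> factors C h k \<longleftrightarrow> is_zero_arrow C (f \<cdot> h)"
proof -
  show *: "f \<in> Arr C" "k \<in> Arr C" "Cod C k = Dom C f" "is_mono C k"
    and iff: "\<And>h. h \<in> Arr C \<Longrightarrow> Cod C h = Dom C f \<Longrightarrow> factors C h k \<longleftrightarrow> is_zero_arrow C (f \<cdot> h)"
    using assms is_mono_Arr[of C k] by (auto simp: is_kernel_iff)
  show "is_zero_arrow C (f \<cdot> k)"
    using iff[of k] * factors_refl by simp
qed

lemma kernel_unique:
  assumes "is_kernel C f k" "is_kernel C f k'"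
  shows "factors C k k'"
  using kernel_simps[OF assms(1)] kernel_simps[OF assms(2)] by simp

text \<open>Equivalent monomorphisms have the same arrows factoring through them, so being a kernel
  of \<open>f\<close> depends only on the subobject. This moves the property from a constructed
  kernel to an arbitrary one.\<close>

lemma kernel_equiv:
  assumes k: "is_kernel C f k" and k': "is_mono C k'" "factors C k k'" "factors C k' k" "Cod C k' = Cod C k"
  shows "is_kernel C f k'"
proof -
  note K = kernel_simps[OF k]
  have "factors C h k' = factors C h k" for h
    using factors_trans k' K(2) is_mono_Arr[OF k'(1)] by blast
  then show ?thesis using K k' by (auto simp: is_kernel_iff)
qed

end

text \<open>Isolates what functor categories are going to provide: zero arrows between any two
  objects, without the other axioms of an abelian category.\<close>

locale category_with_zero = category +
  assumes zero_object: "\<exists>Z. is_zero_object C Z"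
begin

lemma zero_arrow_ex:
  assumes "X \<in> Ob C" "Y \<in> Ob C"
  shows "\<exists>z. is_zero_arrow C z \<and> Dom C z = X \<and> Cod C z = Y"
proof -
  obtain Z where Z: "is_zero_object C Z" using zero_object by blast
  obtain g h where gh: "g \<in> Hom C X Z" "h \<in> Hom C Z Y"
    using Z assms unfolding is_zero_object_def by (meson ex1_implies_ex)
  then have "h \<cdot> g \<in> Arr C" "Dom C (h \<cdot> g) = X" "Cod C (h \<cdot> g) = Y"
    by (auto simp: Hom_def)
  then show ?thesis using Z gh unfolding is_zero_arrow_def by blast
qed

lemma mono_comp_zero:
  assumes m: "is_mono C m" and f: "f \<in> Arr C" "Cod C f = Dom C m" and "is_zero_arrow C (m \<cdot> f)"
  shows "is_zero_arrow C f"
proof -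
  have mA: "m \<in> Arr C" using m by (rule is_mono_Arr)
  obtain z where z: "is_zero_arrow C z" "Dom C z = Dom C f" "Cod C z = Dom C m"
    using zero_arrow_ex[of "Dom C f" "Dom C m"] f mA by auto
  have "m \<cdot> z = m \<cdot> f"
    by (rule zero_arrow_unique)
      (use z f mA assms(4) zero_arrow_comp_left[OF z(1) mA] in \<open>auto simp: is_zero_arrow_Arr\<close>)
  then have "z = f"
    using is_mono_cancel[OF m, of z f] z f by (simp add: is_zero_arrow_Arr)
  then show ?thesis using z by simp
qed

end

section \<open>Abelian categories and products\<close>

sublocale abelian_category \<subseteq> category_with_zero
  by unfold_locales (fact zero_object)

text \<open>Factoring through \<open>q\<close> in the opposite category means extending along
  \<open>q\<close>; in this way the facts on kernels, read in \<open>op_cat C\<close>, become the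
  universal property of cokernels.\<close>

lemma factors_op_iff:
  "factors (op_cat C) h q \<longleftrightarrow> (\<exists>u\<in>Arr C. Dom C u = Cod C q \<and> Cod C u = Cod C h \<and> u \<cdot>\<^bsub>C\<^esub> q = h)"
  by (auto simp: factors_iff)

lemma is_epi_cancel:
  "\<lbrakk>is_epi C e; f \<in> Arr C; g \<in> Arr C; Dom C f = Cod C e; Dom C g = Cod C e; Cod C f = Cod C g;
    f \<cdot>\<^bsub>C\<^esub> e = g \<cdot>\<^bsub>C\<^esub> e\<rbrakk> \<Longrightarrow> f = g"
  using is_mono_cancel[of "op_cat C" e f g] by (simp add: is_epi_def)

context category
begin

lemmas cokernel_simps = category.kernel_simps[OF category_op_cat, folded is_cokernel_def is_epi_def, simplified]

end

context abelian_category
begin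

lemma abelian_category_op_cat: "abelian_category (op_cat C)"
proof -
  interpret O: category "op_cat C" by (rule category_op_cat)
  show ?thesis
    by unfold_locales
      (simp_all add: zero_object binary_products binary_coproducts
        kernels[unfolded is_cokernel_def] cokernels[unfolded is_cokernel_def] is_cokernel_def
        is_epi_def mono_is_kernel epi_is_cokernel[unfolded is_epi_def is_cokernel_def])
qed

text \<open>The monomorphism is the kernel of some \<open>f\<close>, which kills \<open>m\<close>
  and hence extends along the cokernel \<open>q\<close> as \<open>f = v \<cdot> q\<close>. So
  whatever \<open>q\<close> kills, \<open>f\<close> kills too, and it factors through
  \<open>m\<close>.\<close>

lemma mono_kernel_of_cokernel:
  assumes m: "is_mono C m" and q: "is_cokernel C m q"
  shows "is_kernel C q m"
proof -
  note Q = cokernel_simps[OF q]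
  obtain f where f: "is_kernel C f m" using mono_is_kernel[OF m] by blast
  note F = kernel_simps[OF f]
  obtain v where v: "v \<in> Arr C" "Dom C v = Cod C q" "v \<cdot> q = f"
    using Q(6)[of f] F unfolding factors_op_iff by force
  have "factors C h m = is_zero_arrow C (q \<cdot> h)" if h: "h \<in> Arr C" "Cod C h = Dom C q" for h
  proof
    assume "factors C h m"
    then obtain u where u: "u \<in> Arr C" "Cod C u = Dom C m" "m \<cdot> u = h" by (rule factorsE)
    then show "is_zero_arrow C (q \<cdot> h)"
      using zero_arrow_comp_right[OF Q(5), of u] Comp_Comp[of u m q] Q by simp
  next
    assume "is_zero_arrow C (q \<cdot> h)"
    then have "is_zero_arrow C (v \<cdot> (q \<cdot> h))"
      using zero_arrow_comp_left v h Q by simp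
    moreover have "v \<cdot> (q \<cdot> h) = f \<cdot> h" using Comp_Comp[of h q v] v h Q by simp
    ultimately show "factors C h m" using F(3,6) h Q by simp
  qed
  then show ?thesis using m Q by (simp add: is_kernel_iff)
qed

lemma epi_cokernel_of_kernel:
  assumes "is_epi C e" and "is_kernel C e k"
  shows "is_cokernel C k e"
  using abelian_category.mono_kernel_of_cokernel[OF abelian_category_op_cat, of e k] assms
  by (simp add: is_epi_def is_cokernel_def)

text \<open>Freyd: the equalizer of \<open>a\<close> and \<open>b\<close> is the intersection of their graphs.\<close>

lemma equalizer_ex:
  assumes a: "a \<in> Arr C" and b: "b \<in> Arr C" and D: "Dom C a = Dom C b" and K: "Cod C a = Cod C b"
  obtains e where "is_mono C e" "Cod C e = Dom C a"
    "\<And>h. h \<in> Arr C \<Longrightarrow> Cod C h = Dom C a \<Longrightarrow> factors C h e \<longleftrightarrow> a \<cdot> h = b \<cdot> h"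
proof -
  define X Y where "X = Dom C a" and "Y = Cod C a"
  have XY: "X \<in> Ob C" "Y \<in> Ob C" using a by (auto simp: X_def Y_def)
  obtain P p where P: "is_product C (UNIV :: bool set) (\<lambda>b. if b then X else Y) P p"
    using binary_products[OF XY] by blast
  define p1 p2 where "p1 = p True" and "p2 = p False"
  have p: "p1 \<in> Arr C" "Dom C p1 = P" "Cod C p1 = X" "p2 \<in> Arr C" "Dom C p2 = P" "Cod C p2 = Y"
    and PO: "P \<in> Ob C"
    using P by (auto simp: is_product_def Hom_def p1_def p2_def all_bool_eq)
  have univ: "\<exists>!u. u \<in> Hom C W P \<and> p1 \<cdot> u = f \<and> p2 \<cdot> u = g"
    if "f \<in> Hom C W X" "g \<in> Hom C W Y" "W \<in> Ob C" for f g W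
  proof -
    have "\<forall>f. (\<forall>i\<in>UNIV. f i \<in> Hom C W (if i then X else Y)) \<longrightarrow>
       (\<exists>!u. u \<in> Hom C W P \<and> (\<forall>i\<in>UNIV. p i \<cdot> u = f i))"
      using P that(3) unfolding is_product_def by blast
    from this[rule_format, of "\<lambda>b. if b then f else g"] that show ?thesis
      by (simp add: all_bool_eq p1_def p2_def conj_commute)
  qed
  have graph: "\<exists>g. g \<in> Arr C \<and> Dom C g = X \<and> Cod C g = P \<and> p1 \<cdot> g = Idt C X \<and> p2 \<cdot> g = f"
    if "f \<in> Arr C" "Dom C f = X" "Cod C f = Y" for f
    using univ[of "Idt C X" X f] that XY by (auto simp: Hom_def)
  obtain ga where ga: "ga \<in> Arr C" "Dom C ga = X" "Cod C ga = P" "p1 \<cdot> ga = Idt C X" "p2 \<cdot> ga = a"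
    using graph[of a] a by (auto simp: X_def Y_def)
  obtain gb where gb: "gb \<in> Arr C" "Dom C gb = X" "Cod C gb = P" "p1 \<cdot> gb = Idt C X" "p2 \<cdot> gb = b"
    using graph[of b] b D K by (auto simp: X_def Y_def)
  have pga: "p1 \<cdot> (ga \<cdot> h) = h" "p2 \<cdot> (ga \<cdot> h) = a \<cdot> h" "p1 \<cdot> (gb \<cdot> h) = h" "p2 \<cdot> (gb \<cdot> h) = b \<cdot> h"
    if "h \<in> Arr C" "Cod C h = X" for h
    using Comp_Comp[of h ga p1] Comp_Comp[of h ga p2] Comp_Comp[of h gb p1] Comp_Comp[of h gb p2]
      that p ga gb by simp_all
  have "is_mono C ga"
  proof (rule is_monoI[OF ga(1)])
    fix f g assume *: "f \<in> Arr C" "g \<in> Arr C" "Cod C f = Dom C ga" "Cod C g = Dom C ga" "ga \<cdot> f = ga \<cdot> g"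
    then show "f = g" using pga(1)[of f] pga(1)[of g] ga(2) by metis
  qed
  then obtain c where c: "is_kernel C c ga" using mono_is_kernel by blast
  note c = kernel_simps[OF c]
  \<comment> \<open>With \<open>ga\<close> the kernel of \<open>c\<close>, the kernel
    \<open>e\<close> of \<open>c \<cdot> gb\<close> collects the arrows \<open>h\<close> for which
    \<open>gb \<cdot> h\<close> lies in the graph of \<open>a\<close>.\<close>
  have cgb: "c \<cdot> gb \<in> Arr C" "Dom C (c \<cdot> gb) = X" using c gb ga by auto
  obtain e where e: "is_kernel C (c \<cdot> gb) e" using kernels[OF cgb(1)] by blast
  note e = kernel_simps[OF e]
  have "factors C h e \<longleftrightarrow> a \<cdot> h = b \<cdot> h" if h: "h \<in> Arr C" "Cod C h = X" for h
  proof -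
    have "factors C h e \<longleftrightarrow> is_zero_arrow C ((c \<cdot> gb) \<cdot> h)" using e(6)[of h] h cgb by simp
    also have "(c \<cdot> gb) \<cdot> h = c \<cdot> (gb \<cdot> h)" using c gb ga h by simp
    also have "is_zero_arrow C (c \<cdot> (gb \<cdot> h)) \<longleftrightarrow> factors C (gb \<cdot> h) ga" using c ga gb h by simp
    also have "\<dots> \<longleftrightarrow> a \<cdot> h = b \<cdot> h"
    proof
      assume "factors C (gb \<cdot> h) ga"
      then obtain u where u: "u \<in> Arr C" "Cod C u = X" "ga \<cdot> u = gb \<cdot> h"
        using ga(2) by (metis factorsE)
      \<comment> \<open>The first projection of both graphs is the identity, which forces
        \<open>u = h\<close>; the second projection then compares \<open>a\<close> and
        \<open>b\<close>.\<close>
      then have "u = h" using pga(1)[of u] pga(3)[of h] h by metis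
      then show "a \<cdot> h = b \<cdot> h" using u pga(2)[of h] pga(4)[of h] h by metis
    next
      assume ab: "a \<cdot> h = b \<cdot> h"
      have "\<exists>!u. u \<in> Hom C (Dom C h) P \<and> p1 \<cdot> u = h \<and> p2 \<cdot> u = a \<cdot> h"
        by (rule univ) (use h a in \<open>auto simp: Hom_def X_def Y_def\<close>)
      moreover have "ga \<cdot> h \<in> Hom C (Dom C h) P" "gb \<cdot> h \<in> Hom C (Dom C h) P"
        using ga gb h by (auto simp: Hom_def)
      ultimately have "ga \<cdot> h = gb \<cdot> h" using pga[OF h] ab by metis
      then show "factors C (gb \<cdot> h) ga" using factors_compI[of ga h] h ga by simp
    qed
    finally show ?thesis .
  qed
  then show ?thesis using that[of e] e cgb by (simp add: X_def)
qed

text \<open>No subtraction of \<open>x\<close> and \<open>y\<close> is at hand, so they are merged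
  by their coequalizer \<open>q\<close>. As \<open>f\<close> extends along \<open>q\<close>, and
  \<open>q\<close> is the cokernel of some \<open>g\<close>, the arrow \<open>g\<close> is killed by
  \<open>f\<close> and passes through the zero kernel \<open>k\<close>. The cokernel of a zero arrow
  has a left inverse, so \<open>q \<cdot> x = q \<cdot> y\<close> yields
  \<open>x = y\<close>.\<close>

lemma mono_if_zero_kernel:
  assumes k: "is_kernel C f k" "is_zero_arrow C k"
  shows "is_mono C f"
proof -
  note K = kernel_simps[OF k(1)]
  show ?thesis
  proof (rule is_monoI[OF K(1)])
    fix x y assume xy: "x \<in> Arr C" "y \<in> Arr C" "Cod C x = Dom C f" "Cod C y = Dom C f"
      "Dom C x = Dom C y" "f \<cdot> x = f \<cdot> y"
    interpret O: abelian_category "op_cat C" by (rule abelian_category_op_cat)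
    \<comment> \<open>The coequalizer is the equalizer formed in the opposite category.\<close>
    obtain q where q: "is_epi C q" "Dom C q = Dom C f"
      and coeq: "\<And>h. h \<in> Arr C \<Longrightarrow> Dom C h = Dom C f \<Longrightarrow> factors (op_cat C) h q \<longleftrightarrow> h \<cdot> x = h \<cdot> y"
      using O.equalizer_ex[of x y] xy by (auto simp: is_epi_def)
    obtain g where g: "is_cokernel C g q" using epi_is_cokernel[OF q(1)] by blast
    note G = cokernel_simps[OF g]
    obtain f' where f': "f' \<in> Arr C" "Dom C f' = Cod C q" "f' \<cdot> q = f"
      using coeq[of f] K xy unfolding factors_op_iff by force
    have "is_zero_arrow C (f' \<cdot> (q \<cdot> g))" using zero_arrow_comp_left[OF G(5)] f' G by simp
    moreover have "f' \<cdot> (q \<cdot> g) = f \<cdot> g" using Comp_Comp[of g q f'] f' G by simp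
    ultimately have "factors C g k" using K(6)[of g] G q by simp
    then obtain u where "u \<in> Arr C" "Cod C u = Dom C k" "k \<cdot> u = g" by (rule factorsE)
    \<comment> \<open>\<open>g\<close> is zero, so the identity extends along its cokernel
      \<open>q\<close>; the extension \<open>d\<close> is a left inverse of
      \<open>q\<close>.\<close>
    then have "is_zero_arrow C (Idt C (Dom C q) \<cdot> g)"
      using zero_arrow_comp_right[OF k(2), of u] G by simp
    then obtain d where d: "d \<in> Arr C" "Dom C d = Cod C q" "d \<cdot> q = Idt C (Dom C q)"
      using G(6)[of "Idt C (Dom C q)"] G unfolding factors_op_iff by force
    have "q \<cdot> x = q \<cdot> y" using coeq[of q] O.factors_refl[of q] G q by simp
    then have "(d \<cdot> q) \<cdot> x = (d \<cdot> q) \<cdot> y" using d(1,2) xy G q by simp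
    then show "x = y" using d xy q by simp
  qed
qed

end

section \<open>Products of small families\<close>

lemma is_product_Arr:
  assumes "is_product C I X P p"
  shows "P \<in> Ob C" "\<And>i. i \<in> I \<Longrightarrow> p i \<in> Arr C" "\<And>i. i \<in> I \<Longrightarrow> Dom C (p i) = P"
    "\<And>i. i \<in> I \<Longrightarrow> Cod C (p i) = X i"
  using assms by (auto simp: is_product_def Hom_def)

lemma is_product_lift:
  assumes "is_product C I X P p" "Y \<in> Ob C" "\<And>i. i \<in> I \<Longrightarrow> f i \<in> Hom C Y (X i)"
  shows "\<exists>!u. u \<in> Hom C Y P \<and> (\<forall>i\<in>I. p i \<cdot>\<^bsub>C\<^esub> u = f i)"
  using assms unfolding is_product_def by blast

lemma (in category) is_product_eqI:
  assumes P: "is_product C I X P p" and "u \<in> Arr C" "v \<in> Arr C" "Cod C u = P" "Cod C v = P" "Dom C u = Dom C v"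
    "\<And>i. i \<in> I \<Longrightarrow> p i \<cdot> u = p i \<cdot> v"
  shows "u = v"
proof -
  have "\<exists>!w. w \<in> Hom C (Dom C u) P \<and> (\<forall>i\<in>I. p i \<cdot> w = p i \<cdot> v)"
    by (rule is_product_lift[OF P]) (use is_product_Arr[OF P] assms in \<open>auto simp: Hom_def\<close>)
  moreover have "u \<in> Hom C (Dom C u) P" "v \<in> Hom C (Dom C u) P" using assms by (simp_all add: Hom_def)
  ultimately show ?thesis using assms(7) by metis
qed

lemma (in category_with_zero) is_product_zero_iff:
  assumes P: "is_product C I X P p" and u: "u \<in> Arr C" "Cod C u = P"
  shows "is_zero_arrow C u \<longleftrightarrow> (\<forall>i\<in>I. is_zero_arrow C (p i \<cdot> u))"
proof
  note p = is_product_Arr[OF P]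
  show "is_zero_arrow C u \<Longrightarrow> \<forall>i\<in>I. is_zero_arrow C (p i \<cdot> u)"
    using zero_arrow_comp_left p u by simp
  assume *: "\<forall>i\<in>I. is_zero_arrow C (p i \<cdot> u)"
  obtain z where z: "is_zero_arrow C z" "Dom C z = Dom C u" "Cod C z = P"
    using zero_arrow_ex[of "Dom C u" P] p u by auto
  note zA = is_zero_arrow_Arr[OF z(1)]
  have "z = u"
  proof (rule is_product_eqI[OF P])
    fix i assume i: "i \<in> I"
    then show "p i \<cdot> z = p i \<cdot> u"
      using * zero_arrow_unique[of "p i \<cdot> z" "p i \<cdot> u"] zero_arrow_comp_left[OF z(1), of "p i"] p(2-4)[of i] u z zA
      by simp
  qed (use z zA u in auto)
  then show "is_zero_arrow C u" using z by simp
qed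

lemma small_cong: "A \<approx> B \<Longrightarrow> small U A \<longleftrightarrow> small U B"
  unfolding small_def lesspoll_def by (meson eqpoll_sym eqpoll_trans lepoll_trans1)

lemma small_subset: "small U B \<Longrightarrow> A \<subseteq> B \<Longrightarrow> small U A"
  unfolding small_def by (meson lesspoll_trans1 subset_imp_lepoll)

text \<open>\<open>complete\<close> only speaks of diagram shapes inside the universe type. An
  injection \<open>e\<close> carries the index set there, and a product is a limit over the
  resulting discrete category.\<close>

lemma complete_product_ex:
  fixes C :: "('o, 'a) cat" and I :: "'i set"
  assumes C: "complete TYPE('u) C" and I: "small TYPE('u) I" and X: "\<And>i. i \<in> I \<Longrightarrow> X i \<in> Ob C"
    and "category C"
  shows "\<exists>P p. is_product C I X P p"
proof -
  interpret category C by fact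
  obtain e :: "'i \<Rightarrow> 'u" where e: "inj_on e I"
    using I by (auto simp: small_def lesspoll_def lepoll_def)
  \<comment> \<open>All arrows are identities, each named by its object, so composable arrows
    coincide and returning either one is composition.\<close>
  define J :: "('u, 'u) cat" where "J = \<lparr>Ob = e ` I, Arr = e ` I, Dom = id, Cod = id, Idt = id, Comp = (\<lambda>g f. f)\<rparr>"
  have J: "Ob J = e ` I" "Arr J = e ` I" "Dom J = id" "Cod J = id" "Idt J = id" "Comp J = (\<lambda>g f. f)"
    by (simp_all add: J_def)
  have catJ: "category J" by unfold_locales (auto simp: J Hom_def)
  have "I \<approx> e ` I" using e by (auto simp: eqpoll_def bij_betw_def)
  then have sm: "small TYPE('u) (e ` I)" using I small_cong by blast
  define r where "r = the_inv_into I e"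
  have r: "r (e i) = i" if "i \<in> I" for i using that e by (simp add: r_def the_inv_into_f_f)
  define F :: "('u, 'u, 'o, 'a) functr" where
    "F = Functr (\<lambda>j\<in>e ` I. X (r j)) (\<lambda>j\<in>e ` I. Idt C (X (r j)))"
  have F: "omap F (e i) = X i" "amap F (e i) = Idt C (X i)" if "i \<in> I" for i
    using that r by (simp_all add: F_def)
  have "is_functor J C F"
    unfolding is_functor_def by (auto simp: J Hom_def F X) (auto simp: F_def)
  then obtain L l where L: "is_limit J C F L l"
    using C catJ sm unfolding complete_def by (metis J(1,2))
  \<comment> \<open>On a discrete shape the compatibility condition of a cone only involves
    identities and disappears.\<close>
  have cone: "is_cone J C F Y c \<longleftrightarrow> Y \<in> Ob C \<and> (\<forall>i\<in>I. c (e i) \<in> Hom C Y (X i))" for Y c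
    unfolding is_cone_def by (auto simp: J F Hom_def)
  have "is_product C I X L (\<lambda>i. l (e i))"
    unfolding is_product_def
  proof (intro conjI ballI allI impI)
    show "L \<in> Ob C" "\<And>i. i \<in> I \<Longrightarrow> l (e i) \<in> Hom C L (X i)"
      using L by (auto simp: is_limit_def cone)
    fix Y f assume Y: "Y \<in> Ob C" "\<forall>i\<in>I. f i \<in> Hom C Y (X i)"
    then have "is_cone J C F Y (\<lambda>j. f (r j))" by (simp add: cone r)
    then have "\<exists>!u. u \<in> Hom C Y L \<and> (\<forall>j\<in>Ob J. l j \<cdot>\<^bsub>C\<^esub> u = f (r j))"
      using L by (auto simp: is_limit_def)
    then show "\<exists>!u. u \<in> Hom C Y L \<and> (\<forall>i\<in>I. l (e i) \<cdot>\<^bsub>C\<^esub> u = f i)" by (simp add: J r)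
  qed
  then show ?thesis by blast
qed

section \<open>Composites and pullbacks\<close>

lemma (in category) is_mono_comp:
  assumes m: "is_mono C m" and n: "is_mono C n" and "Dom C n = Cod C m"
  shows "is_mono C (n \<cdot> m)"
proof (rule is_monoI)
  note A = is_mono_Arr[OF m] is_mono_Arr[OF n]
  show "n \<cdot> m \<in> Arr C" using A assms(3) by simp
  fix f g assume fg: "f \<in> Arr C" "g \<in> Arr C" "Cod C f = Dom C (n \<cdot> m)" "Cod C g = Dom C (n \<cdot> m)"
    "Dom C f = Dom C g" "(n \<cdot> m) \<cdot> f = (n \<cdot> m) \<cdot> g"
  have D: "Dom C (n \<cdot> m) = Dom C m" using A assms(3) by simp
  have "m \<cdot> f = m \<cdot> g"
    by (rule is_mono_cancel[OF n]) (use fg D A assms(3) in auto)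
  then show "f = g"
    by (rule is_mono_cancel[OF m, rotated 5]) (use fg D in auto)
qed

lemma (in category) is_epi_comp:
  "\<lbrakk>is_epi C f; is_epi C g; Dom C g = Cod C f\<rbrakk> \<Longrightarrow> is_epi C (g \<cdot> f)"
  using category.is_mono_comp[OF category_op_cat, of g f] by (simp add: is_epi_def)

text \<open>Both sides have the same test: \<open>h\<close> belongs to the subobject iff
  \<open>q \<cdot> h\<close> factors through \<open>m\<close>, which for a kernel \<open>m\<close>
  of \<open>c\<close> says that \<open>c\<close> kills \<open>q \<cdot> h\<close>. It reduces the
  pullbacks that define \<open>(s : t)\<close> to kernels, which are available in functor
  categories.\<close>

lemma (in category) kernel_comp_iff_pullback:
  assumes m: "is_kernel C c m" and q: "q \<in> Arr C" "Cod C q = Dom C c"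
  shows "is_kernel C (c \<cdot> q) p \<longleftrightarrow> (\<exists>y. is_pullback C q m p y)"
proof -
  note M = kernel_simps[OF m]
  have cq: "c \<cdot> q \<in> Arr C" "Dom C (c \<cdot> q) = Dom C q" using M q by auto
  have key: "is_zero_arrow C ((c \<cdot> q) \<cdot> h) \<longleftrightarrow> factors C (q \<cdot> h) m" if "h \<in> Arr C" "Cod C h = Dom C q" for h
    using that M q by simp
  show ?thesis
  proof
    assume p: "is_kernel C (c \<cdot> q) p"
    note P = kernel_simps[OF p]
    have Pq: "Cod C p = Dom C q" using P cq by simp
    have "factors C (q \<cdot> p) m" using P(5) key[OF P(2) Pq] by simp
    then obtain y where y: "y \<in> Arr C" "Dom C y = Dom C p" "Cod C y = Dom C m" "m \<cdot> y = q \<cdot> p"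
      using q P(2) Pq by (auto elim: factorsE)
    have "\<exists>!u. u \<in> Hom C X (Dom C p) \<and> p \<cdot> u = a \<and> y \<cdot> u = b"
      if "a \<in> Hom C X (Dom C q)" "b \<in> Hom C X (Dom C m)" and ab: "q \<cdot> a = m \<cdot> b" for X a b
    proof -
      have a: "a \<in> Arr C" "Cod C a = Dom C q" "Dom C a = X" and b: "b \<in> Arr C" "Cod C b = Dom C m" "Dom C b = X"
        using that by (auto simp: Hom_def)
      have "factors C (q \<cdot> a) m" using factors_compI[of m b] M b ab by simp
      then have "factors C a p" using key[OF a(1,2)] P(6)[of a] a cq by simp
      then obtain u where u: "u \<in> Arr C" "Dom C u = X" "Cod C u = Dom C p" "p \<cdot> u = a"
        using a by (auto elim: factorsE)
      have "y \<cdot> u = b"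
      proof (rule is_mono_cancel[OF M(4)])
        have "m \<cdot> (y \<cdot> u) = (m \<cdot> y) \<cdot> u" using u(1-3) y(1-3) M by simp
        also have "\<dots> = (q \<cdot> p) \<cdot> u" using y by simp
        also have "\<dots> = q \<cdot> (p \<cdot> u)" using u P(2) Pq q by simp
        finally show "m \<cdot> (y \<cdot> u) = m \<cdot> b" using u ab by simp
      qed (use u y b in auto)
      moreover have "v = u" if "v \<in> Hom C X (Dom C p)" "p \<cdot> v = a" for v
        by (rule is_mono_cancel[OF P(4)]) (use that u in \<open>auto simp: Hom_def\<close>)
      moreover have "u \<in> Hom C X (Dom C p)" using u by (simp add: Hom_def)
      ultimately show ?thesis using u(4) by (blast intro: ex1I[of _ u])
    qed
    then have "is_pullback C q m p y"
      using y q M P(2) Pq by (simp add: is_pullback_def)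
    then show "\<exists>y. is_pullback C q m p y" by blast
  next
    assume "\<exists>y. is_pullback C q m p y"
    then obtain y where y: "is_pullback C q m p y" by blast
    then have p: "p \<in> Arr C" "Cod C p = Dom C q" and yA: "y \<in> Arr C" "Dom C y = Dom C p" "Cod C y = Dom C m"
      and sq: "q \<cdot> p = m \<cdot> y" by (auto simp: is_pullback_def)
    have univ: "\<exists>!u. u \<in> Hom C X (Dom C p) \<and> p \<cdot> u = a \<and> y \<cdot> u = b"
      if "a \<in> Hom C X (Dom C q)" "b \<in> Hom C X (Dom C m)" "q \<cdot> a = m \<cdot> b" for X a b
      using y that unfolding is_pullback_def by blast
    have sq': "q \<cdot> (p \<cdot> f) = m \<cdot> (y \<cdot> f)" if "f \<in> Arr C" "Cod C f = Dom C p" for f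
    proof -
      have "q \<cdot> (p \<cdot> f) = (q \<cdot> p) \<cdot> f" using that p q by simp
      also have "\<dots> = m \<cdot> (y \<cdot> f)" unfolding sq using that yA M by simp
      finally show ?thesis .
    qed
    have mono: "is_mono C p"
    proof (rule is_monoI[OF p(1)])
      fix f g assume fg: "f \<in> Arr C" "g \<in> Arr C" "Cod C f = Dom C p" "Cod C g = Dom C p"
        "Dom C f = Dom C g" "p \<cdot> f = p \<cdot> g"
      \<comment> \<open>Monicity of \<open>m\<close> recovers the second leg from the first, so
        \<open>p\<close> alone determines an arrow into the pullback.\<close>
      have "y \<cdot> f = y \<cdot> g"
        by (rule is_mono_cancel[OF M(4)]) (use fg sq'[of f] sq'[of g] yA in auto)
      moreover have "\<exists>!u. u \<in> Hom C (Dom C f) (Dom C p) \<and> p \<cdot> u = p \<cdot> f \<and> y \<cdot> u = y \<cdot> f"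
        by (rule univ) (use fg(1,3) sq'[OF fg(1,3)] p yA in \<open>auto simp: Hom_def\<close>)
      moreover have "f \<in> Hom C (Dom C f) (Dom C p)" "g \<in> Hom C (Dom C f) (Dom C p)"
        using fg by (simp_all add: Hom_def)
      ultimately show "f = g" using fg(6) by metis
    qed
    have "factors C h p = is_zero_arrow C ((c \<cdot> q) \<cdot> h)" if h: "h \<in> Arr C" "Cod C h = Dom C q" for h
    proof
      assume "factors C h p"
      then obtain u where u: "u \<in> Arr C" "Cod C u = Dom C p" "p \<cdot> u = h" by (rule factorsE)
      then have "factors C (q \<cdot> h) m"
        using sq'[OF u(1,2)] factors_compI[of m "y \<cdot> u"] M yA by simp
      then show "is_zero_arrow C ((c \<cdot> q) \<cdot> h)" using key[OF h] by simp
    next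
      assume "is_zero_arrow C ((c \<cdot> q) \<cdot> h)"
      then have "factors C (q \<cdot> h) m" using key[OF h] by simp
      then obtain b where b: "b \<in> Arr C" "Dom C b = Dom C h" "Cod C b = Dom C m" "m \<cdot> b = q \<cdot> h"
        using h q by (auto elim: factorsE)
      then have "\<exists>!u. u \<in> Hom C (Dom C h) (Dom C p) \<and> p \<cdot> u = h \<and> y \<cdot> u = b"
        by (intro univ) (use h in \<open>simp_all add: Hom_def\<close>)
      then show "factors C h p" by (auto simp: factors_iff Hom_def)
    qed
    then show "is_kernel C (c \<cdot> q) p"
      unfolding is_kernel_iff using cq mono p by simp
  qed
qed

section \<open>Functor categories\<close>

lemma Fun_simps [simp]:
  "F \<in> Ob (Fun C D) \<longleftrightarrow> is_functor C D F" "Dom (Fun C D) = nsrc" "Cod (Fun C D) = ntgt"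
  "nsrc (t \<cdot>\<^bsub>Fun C D\<^esub> s) = nsrc s" "ntgt (t \<cdot>\<^bsub>Fun C D\<^esub> s) = ntgt t"
  "X \<in> Ob C \<Longrightarrow> ncomp (t \<cdot>\<^bsub>Fun C D\<^esub> s) X = ncomp t X \<cdot>\<^bsub>D\<^esub> ncomp s X"
  by (simp_all add: Fun_def)

lemma functor_simps:
  assumes "is_functor C D F"
  shows "X \<in> Ob C \<Longrightarrow> omap F X \<in> Ob D" "X \<in> Ob C \<Longrightarrow> amap F (Idt C X) = Idt D (omap F X)"
    "f \<in> Arr C \<Longrightarrow> amap F f \<in> Arr D" "f \<in> Arr C \<Longrightarrow> Dom D (amap F f) = omap F (Dom C f)"
    "f \<in> Arr C \<Longrightarrow> Cod D (amap F f) = omap F (Cod C f)"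
    "\<lbrakk>f \<in> Arr C; g \<in> Arr C; Dom C g = Cod C f\<rbrakk> \<Longrightarrow> amap F (g \<cdot>\<^bsub>C\<^esub> f) = amap F g \<cdot>\<^bsub>D\<^esub> amap F f"
  using assms by (auto simp: is_functor_def Hom_def)

lemma functorI:
  assumes "category C"
    and "\<And>X. X \<in> Ob C \<Longrightarrow> ob X \<in> Ob D \<and> ar (Idt C X) = Idt D (ob X)"
    and "\<And>f. f \<in> Arr C \<Longrightarrow> ar f \<in> Hom D (ob (Dom C f)) (ob (Cod C f))"
    and "\<And>f g. \<lbrakk>f \<in> Arr C; g \<in> Arr C; Dom C g = Cod C f\<rbrakk> \<Longrightarrow> ar (g \<cdot>\<^bsub>C\<^esub> f) = ar g \<cdot>\<^bsub>D\<^esub> ar f"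
  shows "is_functor C D (Functr (restrict ob (Ob C)) (restrict ar (Arr C)))"
proof -
  interpret category C by fact
  show ?thesis using assms(2-) by (simp add: is_functor_def)
qed

lemma nattr_simps:
  assumes "t \<in> Arr (Fun C D)"
  shows "is_functor C D (nsrc t)" "is_functor C D (ntgt t)"
    "X \<in> Ob C \<Longrightarrow> ncomp t X \<in> Arr D" "X \<in> Ob C \<Longrightarrow> Dom D (ncomp t X) = omap (nsrc t) X"
    "X \<in> Ob C \<Longrightarrow> Cod D (ncomp t X) = omap (ntgt t) X"
  using assms by (auto simp: Fun_def is_nattrans_def Hom_def)

lemma naturality:
  assumes "t \<in> Arr (Fun C D)" "f \<in> Arr C" "Dom C f = X" "Cod C f = Y"
  shows "amap (ntgt t) f \<cdot>\<^bsub>D\<^esub> ncomp t X = ncomp t Y \<cdot>\<^bsub>D\<^esub> amap (nsrc t) f"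
  using assms by (auto simp: Fun_def is_nattrans_def)

lemma nattrI:
  assumes "category C" "is_functor C D F" "is_functor C D G"
    "\<And>X. X \<in> Ob C \<Longrightarrow> c X \<in> Hom D (omap F X) (omap G X)"
    "\<And>f. f \<in> Arr C \<Longrightarrow> amap G f \<cdot>\<^bsub>D\<^esub> c (Dom C f) = c (Cod C f) \<cdot>\<^bsub>D\<^esub> amap F f"
  shows "Nattr F G (restrict c (Ob C)) \<in> Arr (Fun C D)"
proof -
  interpret category C by fact
  show ?thesis using assms(2-) by (simp add: Fun_def is_nattrans_def)
qed

lemma nattr_eqI:
  assumes "t \<in> Arr (Fun C D)" "s \<in> Arr (Fun C D)" "nsrc t = nsrc s" "ntgt t = ntgt s"
    "\<And>X. X \<in> Ob C \<Longrightarrow> ncomp t X = ncomp s X"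
  shows "t = s"
proof (rule nattr.expand, intro conjI)
  show "ncomp t = ncomp s"
    by (rule extensionalityI[of _ "Ob C"]) (use assms in \<open>auto simp: Fun_def is_nattrans_def\<close>)
qed (use assms in auto)

lemma category_Fun:
  assumes "category C" "category D"
  shows "category (Fun C D)"
proof -
  interpret C: category C by fact
  interpret D: category D by fact
  have idt: "Idt (Fun C D) F \<in> Arr (Fun C D)" "nsrc (Idt (Fun C D) F) = F" "ntgt (Idt (Fun C D) F) = F"
    "X \<in> Ob C \<Longrightarrow> ncomp (Idt (Fun C D) F) X = Idt D (omap F X)"
    if "is_functor C D F" for F X
  proof -
    have eq: "Idt (Fun C D) F = Nattr F F (\<lambda>X\<in>Ob C. Idt D (omap F X))" by (simp add: Fun_def)
    show "Idt (Fun C D) F \<in> Arr (Fun C D)" unfolding eq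
      by (rule nattrI) (use assms that functor_simps[OF that] in \<open>auto simp: Hom_def\<close>)
  qed (simp_all add: Fun_def)
  have comp: "t \<cdot>\<^bsub>Fun C D\<^esub> s \<in> Arr (Fun C D)"
    if s: "s \<in> Arr (Fun C D)" and t: "t \<in> Arr (Fun C D)" and st: "nsrc t = ntgt s" for s t
  proof -
    note S = nattr_simps[OF s] and T = nattr_simps[OF t]
    have nat: "amap (ntgt t) f \<cdot>\<^bsub>D\<^esub> (ncomp t (Dom C f) \<cdot>\<^bsub>D\<^esub> ncomp s (Dom C f)) =
      ncomp t (Cod C f) \<cdot>\<^bsub>D\<^esub> ncomp s (Cod C f) \<cdot>\<^bsub>D\<^esub> amap (nsrc s) f" if f: "f \<in> Arr C" for f
    proof -
      note A = functor_simps[OF S(1)] functor_simps[OF S(2)] functor_simps[OF T(2)]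
      have "amap (ntgt t) f \<cdot>\<^bsub>D\<^esub> (ncomp t (Dom C f) \<cdot>\<^bsub>D\<^esub> ncomp s (Dom C f)) =
          (amap (ntgt t) f \<cdot>\<^bsub>D\<^esub> ncomp t (Dom C f)) \<cdot>\<^bsub>D\<^esub> ncomp s (Dom C f)"
        using f S T st A by simp
      also have "\<dots> = (ncomp t (Cod C f) \<cdot>\<^bsub>D\<^esub> amap (nsrc t) f) \<cdot>\<^bsub>D\<^esub> ncomp s (Dom C f)"
        using naturality[OF t f] by simp
      also have "\<dots> = ncomp t (Cod C f) \<cdot>\<^bsub>D\<^esub> (amap (ntgt s) f \<cdot>\<^bsub>D\<^esub> ncomp s (Dom C f))"
        using f S T st A by simp
      also have "\<dots> = ncomp t (Cod C f) \<cdot>\<^bsub>D\<^esub> (ncomp s (Cod C f) \<cdot>\<^bsub>D\<^esub> amap (nsrc s) f)"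
        using naturality[OF s f] by simp
      also have "\<dots> = ncomp t (Cod C f) \<cdot>\<^bsub>D\<^esub> ncomp s (Cod C f) \<cdot>\<^bsub>D\<^esub> amap (nsrc s) f"
        using f S T st A by simp
      finally show ?thesis .
    qed
    have eq: "t \<cdot>\<^bsub>Fun C D\<^esub> s = Nattr (nsrc s) (ntgt t) (\<lambda>X\<in>Ob C. ncomp t X \<cdot>\<^bsub>D\<^esub> ncomp s X)"
      by (simp add: Fun_def)
    show ?thesis unfolding eq
      by (rule nattrI[OF assms(1) S(1) T(2)]) (use S T st nat in \<open>auto simp: Hom_def\<close>)
  qed
  show ?thesis
  proof
    fix f assume "f \<in> Arr (Fun C D)"
    then show "Dom (Fun C D) f \<in> Ob (Fun C D)" "Cod (Fun C D) f \<in> Ob (Fun C D)"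
      by (simp_all add: nattr_simps)
  next
    fix F assume "F \<in> Ob (Fun C D)"
    then show "Idt (Fun C D) F \<in> Hom (Fun C D) F F" using idt by (simp add: Hom_def)
  next
    fix f X Y g Z assume "f \<in> Hom (Fun C D) X Y" "g \<in> Hom (Fun C D) Y Z"
    then show "g \<cdot>\<^bsub>Fun C D\<^esub> f \<in> Hom (Fun C D) X Z" using comp by (simp add: Hom_def)
  next
    fix f X Y assume "f \<in> Hom (Fun C D) X Y"
    then have f: "f \<in> Arr (Fun C D)" "nsrc f = X" "ntgt f = Y" by (auto simp: Hom_def)
    have XY: "is_functor C D X" "is_functor C D Y" using nattr_simps(1,2)[OF f(1)] f by auto
    show "Idt (Fun C D) Y \<cdot>\<^bsub>Fun C D\<^esub> f = f"
      by (rule nattr_eqI[of _ C D]) (use f idt[OF XY(2)] comp nattr_simps[OF f(1)] in auto)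
    show "f \<cdot>\<^bsub>Fun C D\<^esub> Idt (Fun C D) X = f"
      by (rule nattr_eqI[of _ C D]) (use f idt[OF XY(1)] comp nattr_simps[OF f(1)] in auto)
  next
    fix f W X g Y h Z assume "f \<in> Hom (Fun C D) W X" "g \<in> Hom (Fun C D) X Y" "h \<in> Hom (Fun C D) Y Z"
    then have fgh: "f \<in> Arr (Fun C D)" "g \<in> Arr (Fun C D)" "h \<in> Arr (Fun C D)" "nsrc g = ntgt f" "nsrc h = ntgt g"
      by (auto simp: Hom_def)
    show "h \<cdot>\<^bsub>Fun C D\<^esub> g \<cdot>\<^bsub>Fun C D\<^esub> f = h \<cdot>\<^bsub>Fun C D\<^esub> (g \<cdot>\<^bsub>Fun C D\<^esub> f)"
      by (rule nattr_eqI[of _ C D])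
        (use fgh comp nattr_simps[OF fgh(1)] nattr_simps[OF fgh(2)] nattr_simps[OF fgh(3)] in auto)
  qed
qed

lemma id_functor_simps [simp]:
  "X \<in> Ob C \<Longrightarrow> omap (id_functor C) X = X" "f \<in> Arr C \<Longrightarrow> amap (id_functor C) f = f"
  by (simp_all add: id_functor_def)

lemma (in category) is_functor_id: "is_functor C C (id_functor C)"
  unfolding id_functor_def by (rule functorI) (auto simp: Hom_def intro: category_axioms)

lemma comp_functor_simps [simp]:
  "X \<in> Ob C \<Longrightarrow> omap (comp_functor C G F) X = omap G (omap F X)"
  "f \<in> Arr C \<Longrightarrow> amap (comp_functor C G F) f = amap G (amap F f)"
  by (simp_all add: comp_functor_def compose_def)

lemma is_functor_comp:
  assumes "category B" "is_functor B C F" "is_functor C D G"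
  shows "is_functor B D (comp_functor B G F)"
proof -
  note F = functor_simps[OF assms(2)] and G = functor_simps[OF assms(3)]
  show ?thesis
    unfolding comp_functor_def compose_def
    by (rule functorI[OF assms(1)]) (auto simp: Hom_def F G)
qed

lemma whisker_simps [simp]:
  "nsrc (whisker C t S) = comp_functor C (nsrc t) S" "ntgt (whisker C t S) = comp_functor C (ntgt t) S"
  "X \<in> Ob C \<Longrightarrow> ncomp (whisker C t S) X = ncomp t (omap S X)"
  by (simp_all add: whisker_def compose_def)

lemma whisker_Arr:
  assumes "category B" "is_functor B C S" "t \<in> Arr (Fun C D)"
  shows "whisker B t S \<in> Arr (Fun B D)"
proof -
  interpret category B by fact
  note S = functor_simps[OF assms(2)] and T = nattr_simps[OF assms(3)]
  show ?thesis
    unfolding whisker_def compose_def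
    by (rule nattrI[OF assms(1) is_functor_comp[OF assms(1,2) T(1)] is_functor_comp[OF assms(1,2) T(2)]])
      (auto simp: Hom_def S T naturality[OF assms(3)])
qed

section \<open>Zero arrows, monomorphisms and subfunctors\<close>

text \<open>The constant functor \<open>K\<close> at a zero object is a zero object of functors. A
  zero arrow between given functors is unique, so it is the composite \<open>z\<close> through
  \<open>K\<close>, whose components pass through \<open>Z\<close>; conversely, vanishing components
  agree with those of \<open>z\<close>.\<close>

lemma Fun_zero_arrow:
  assumes "category C" "category_with_zero D"
  shows category_with_zero_Fun: "category_with_zero (Fun C D)"
    and Fun_zero_iff: "\<And>t. t \<in> Arr (Fun C D) \<Longrightarrow>
      is_zero_arrow (Fun C D) t \<longleftrightarrow> (\<forall>X\<in>Ob C. is_zero_arrow D (ncomp t X))"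
proof -
  interpret C: category C by fact
  interpret D: category_with_zero D by fact
  interpret E: category "Fun C D" by (rule category_Fun) unfold_locales
  obtain Z where Z: "is_zero_object D Z" using D.zero_object by blast
  have ZO: "Z \<in> Ob D" using Z by (simp add: is_zero_object_def)
  \<comment> \<open>Parallel arrows into or out of \<open>Z\<close> coincide; the naturality squares
    involving \<open>K\<close> commute for this reason.\<close>
  have Z_uniq: "f = g" if "f \<in> Arr D" "g \<in> Arr D" "Dom D f = Dom D g" "Cod D f = Cod D g"
    "Dom D f = Z \<or> Cod D f = Z" for f g
  proof (cases "Dom D f = Z")
    case True
    have "\<exists>!h. h \<in> Hom D Z (Cod D f)" using Z that D.Cod_in_Ob unfolding is_zero_object_def by blast
    then show ?thesis using True that by (auto simp: Hom_def)
  next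
    case False
    have "\<exists>!h. h \<in> Hom D (Dom D f) Z" using Z that D.Dom_in_Ob unfolding is_zero_object_def by blast
    then show ?thesis using False that by (auto simp: Hom_def)
  qed
  define to_Z from_Z where "to_Z X = (SOME f. f \<in> Hom D X Z)" and "from_Z X = (SOME f. f \<in> Hom D Z X)" for X
  have to_Z: "to_Z X \<in> Arr D" "Dom D (to_Z X) = X" "Cod D (to_Z X) = Z"
    and from_Z: "from_Z X \<in> Arr D" "Dom D (from_Z X) = Z" "Cod D (from_Z X) = X" if "X \<in> Ob D" for X
  proof -
    have "\<exists>f. f \<in> Hom D X Z" "\<exists>f. f \<in> Hom D Z X"
      using Z that unfolding is_zero_object_def by (meson ex1_implies_ex)+
    then have "to_Z X \<in> Hom D X Z" "from_Z X \<in> Hom D Z X"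
      unfolding to_Z_def from_Z_def by (meson someI_ex)+
    then show "to_Z X \<in> Arr D" "Dom D (to_Z X) = X" "Cod D (to_Z X) = Z"
      "from_Z X \<in> Arr D" "Dom D (from_Z X) = Z" "Cod D (from_Z X) = X"
      by (auto simp: Hom_def)
  qed
  define K where "K = Functr (\<lambda>X\<in>Ob C. Z) (\<lambda>f\<in>Arr C. Idt D Z)"
  have K: "is_functor C D K"
    unfolding K_def by (rule functorI) (auto simp: ZO Hom_def intro: C.category_axioms)
  have Ks: "X \<in> Ob C \<Longrightarrow> omap K X = Z" "f \<in> Arr C \<Longrightarrow> amap K f = Idt D Z" for X f
    by (simp_all add: K_def)
  have ex: "\<exists>g. g \<in> Arr (Fun C D) \<and> nsrc g = F \<and> ntgt g = K" "\<exists>g. g \<in> Arr (Fun C D) \<and> nsrc g = K \<and> ntgt g = F"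
    if F: "is_functor C D F" for F
  proof -
    note Fs = functor_simps[OF F]
    have "Nattr F K (\<lambda>X\<in>Ob C. to_Z (omap F X)) \<in> Arr (Fun C D)"
      by (rule nattrI[OF C.category_axioms F K])
        (auto simp: Hom_def Fs Ks to_Z ZO intro!: Z_uniq)
    then show "\<exists>g. g \<in> Arr (Fun C D) \<and> nsrc g = F \<and> ntgt g = K" by force
    have "Nattr K F (\<lambda>X\<in>Ob C. from_Z (omap F X)) \<in> Arr (Fun C D)"
      by (rule nattrI[OF C.category_axioms K F])
        (auto simp: Hom_def Fs Ks from_Z ZO intro!: Z_uniq)
    then show "\<exists>g. g \<in> Arr (Fun C D) \<and> nsrc g = K \<and> ntgt g = F" by force
  qed
  have uniq: "g = h" if g: "g \<in> Arr (Fun C D)" and h: "h \<in> Arr (Fun C D)"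
    and gh: "nsrc g = nsrc h" "ntgt g = ntgt h" "nsrc g = K \<or> ntgt g = K" for g h
    by (rule nattr_eqI[OF g h gh(1,2)], rule Z_uniq)
      (use nattr_simps[OF g] nattr_simps[OF h] gh Ks in auto)
  have KZ: "is_zero_object (Fun C D) K"
    unfolding is_zero_object_def
  proof (intro conjI ballI)
    fix F assume "F \<in> Ob (Fun C D)"
    then have F: "is_functor C D F" by simp
    show "\<exists>!g. g \<in> Hom (Fun C D) F K" "\<exists>!g. g \<in> Hom (Fun C D) K F"
      using ex[OF F] uniq by (auto simp: Hom_def)
  qed (simp add: K)
  then show zero: "category_with_zero (Fun C D)" by unfold_locales blast
  fix t assume t: "t \<in> Arr (Fun C D)"
  note T = nattr_simps[OF t]
  obtain g where g: "g \<in> Arr (Fun C D)" "nsrc g = nsrc t" "ntgt g = K" using ex(1)[OF T(1)] by blast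
  obtain h where h: "h \<in> Arr (Fun C D)" "nsrc h = K" "ntgt h = ntgt t" using ex(2)[OF T(2)] by blast
  define z where "z = h \<cdot>\<^bsub>Fun C D\<^esub> g"
  have z: "z \<in> Arr (Fun C D)" "nsrc z = nsrc t" "ntgt z = ntgt t" using g h by (auto simp: z_def)
  have "\<exists>g\<in>Hom (Fun C D) (Dom (Fun C D) z) K. \<exists>h\<in>Hom (Fun C D) K (Cod (Fun C D) z). z = h \<cdot>\<^bsub>Fun C D\<^esub> g"
    using g h z z_def by (force simp: Hom_def)
  then have zz: "is_zero_arrow (Fun C D) z"
    using KZ z(1) unfolding is_zero_arrow_def by blast
  have zX: "is_zero_arrow D (ncomp z X)" if X: "X \<in> Ob C" for X
  proof -
    have "ncomp g X \<in> Hom D (Dom D (ncomp z X)) Z" "ncomp h X \<in> Hom D Z (Cod D (ncomp z X))"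
      "ncomp z X = ncomp h X \<cdot>\<^bsub>D\<^esub> ncomp g X"
      using X Ks(1)[OF X] nattr_simps[OF g(1)] nattr_simps[OF h(1)] g h by (simp_all add: Hom_def z_def)
    then show ?thesis using Z nattr_simps(3)[OF z(1) X] unfolding is_zero_arrow_def by blast
  qed
  show "is_zero_arrow (Fun C D) t \<longleftrightarrow> (\<forall>X\<in>Ob C. is_zero_arrow D (ncomp t X))"
  proof
    assume "is_zero_arrow (Fun C D) t"
    then have "t = z" using E.zero_arrow_unique[OF _ zz] z by simp
    then show "\<forall>X\<in>Ob C. is_zero_arrow D (ncomp t X)" using zX by simp
  next
    assume tX: "\<forall>X\<in>Ob C. is_zero_arrow D (ncomp t X)"
    have "t = z"
      by (rule nattr_eqI[OF t z(1)])
        (use z D.zero_arrow_unique zX tX T nattr_simps[OF z(1)] in auto)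
    then show "is_zero_arrow (Fun C D) t" using zz by simp
  qed
qed

lemma Fun_monoI:
  assumes "category D" "m \<in> Arr (Fun C D)" "\<And>X. X \<in> Ob C \<Longrightarrow> is_mono D (ncomp m X)"
  shows "is_mono (Fun C D) m"
proof (rule is_monoI[OF assms(2)])
  interpret D: category D by fact
  fix f g assume fg: "f \<in> Arr (Fun C D)" "g \<in> Arr (Fun C D)" "Cod (Fun C D) f = Dom (Fun C D) m"
    "Cod (Fun C D) g = Dom (Fun C D) m" "Dom (Fun C D) f = Dom (Fun C D) g"
    and eq: "m \<cdot>\<^bsub>Fun C D\<^esub> f = m \<cdot>\<^bsub>Fun C D\<^esub> g"
  note M = nattr_simps[OF assms(2)] and fs = nattr_simps[OF fg(1)] and gs = nattr_simps[OF fg(2)]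
  show "f = g"
  proof (rule nattr_eqI[OF fg(1,2)])
    fix X assume X: "X \<in> Ob C"
    show "ncomp f X = ncomp g X"
    proof (rule is_mono_cancel[OF assms(3)[OF X]])
      show "ncomp m X \<cdot>\<^bsub>D\<^esub> ncomp f X = ncomp m X \<cdot>\<^bsub>D\<^esub> ncomp g X"
        using arg_cong[OF eq, of "\<lambda>t. ncomp t X"] X by simp
    qed (use X fg fs gs M in auto)
  qed (use fg in auto)
qed

text \<open>Factorizations on components are unique because the components of \<open>m\<close> are
  monic, and this uniqueness makes an arbitrary choice of them natural.\<close>

lemma Fun_factors_iff:
  assumes "category C" "category D" "h \<in> Arr (Fun C D)" "m \<in> Arr (Fun C D)" "ntgt h = ntgt m"
    and m: "\<And>X. X \<in> Ob C \<Longrightarrow> is_mono D (ncomp m X)"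
  shows "factors (Fun C D) h m \<longleftrightarrow> (\<forall>X\<in>Ob C. factors D (ncomp h X) (ncomp m X))"
proof
  interpret C: category C by fact
  interpret D: category D by fact
  interpret E: category "Fun C D" by (rule category_Fun) fact+
  note M = nattr_simps[OF assms(4)] and H = nattr_simps[OF assms(3)]
  show "factors (Fun C D) h m \<Longrightarrow> \<forall>X\<in>Ob C. factors D (ncomp h X) (ncomp m X)"
  proof
    fix X assume X: "X \<in> Ob C" and "factors (Fun C D) h m"
    then obtain u where u: "u \<in> Arr (Fun C D)" "nsrc u = nsrc h" "ntgt u = nsrc m" "m \<cdot>\<^bsub>Fun C D\<^esub> u = h"
      by (auto elim: E.factorsE)
    have "factors D (ncomp m X \<cdot>\<^bsub>D\<^esub> ncomp u X) (ncomp m X)"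
      by (rule D.factors_compI) (use X u nattr_simps[OF u(1)] M in auto)
    then show "factors D (ncomp h X) (ncomp m X)" using X u(4) Fun_simps(6) by metis
  qed
  assume "\<forall>X\<in>Ob C. factors D (ncomp h X) (ncomp m X)"
  then have "\<forall>X. \<exists>u. X \<in> Ob C \<longrightarrow> u \<in> Arr D \<and> Dom D u = Dom D (ncomp h X) \<and> Cod D u = Dom D (ncomp m X)
      \<and> ncomp m X \<cdot>\<^bsub>D\<^esub> u = ncomp h X"
    unfolding factors_iff by blast
  then obtain u where u: "\<And>X. X \<in> Ob C \<Longrightarrow> u X \<in> Arr D" "\<And>X. X \<in> Ob C \<Longrightarrow> Dom D (u X) = omap (nsrc h) X"
    "\<And>X. X \<in> Ob C \<Longrightarrow> Cod D (u X) = omap (nsrc m) X" and mu: "\<And>X. X \<in> Ob C \<Longrightarrow> ncomp m X \<cdot>\<^bsub>D\<^esub> u X = ncomp h X"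
    using H M by metis
  define v where "v = Nattr (nsrc h) (nsrc m) (restrict u (Ob C))"
  have v: "v \<in> Arr (Fun C D)" unfolding v_def
  proof (rule nattrI[OF assms(1) H(1) M(1)])
    fix f assume f: "f \<in> Arr C"
    let ?X = "Dom C f" and ?Y = "Cod C f"
    have XY: "?X \<in> Ob C" "?Y \<in> Ob C" using f by auto
    note A = functor_simps[OF H(1)] functor_simps[OF M(1)] functor_simps[OF M(2)]
    show "amap (nsrc m) f \<cdot>\<^bsub>D\<^esub> u ?X = u ?Y \<cdot>\<^bsub>D\<^esub> amap (nsrc h) f"
    proof (rule is_mono_cancel[OF m[OF XY(2)]])
      have "ncomp m ?Y \<cdot>\<^bsub>D\<^esub> (amap (nsrc m) f \<cdot>\<^bsub>D\<^esub> u ?X) = (ncomp m ?Y \<cdot>\<^bsub>D\<^esub> amap (nsrc m) f) \<cdot>\<^bsub>D\<^esub> u ?X"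
        using f u M A XY by simp
      also have "\<dots> = (amap (ntgt m) f \<cdot>\<^bsub>D\<^esub> ncomp m ?X) \<cdot>\<^bsub>D\<^esub> u ?X"
        using naturality[OF assms(4) f] by simp
      also have "\<dots> = amap (ntgt m) f \<cdot>\<^bsub>D\<^esub> (ncomp m ?X \<cdot>\<^bsub>D\<^esub> u ?X)"
        using f u M A XY by simp
      also have "\<dots> = ncomp h ?Y \<cdot>\<^bsub>D\<^esub> amap (nsrc h) f"
        using naturality[OF assms(3) f] mu XY assms(5) by simp
      also have "\<dots> = (ncomp m ?Y \<cdot>\<^bsub>D\<^esub> u ?Y) \<cdot>\<^bsub>D\<^esub> amap (nsrc h) f"
        using mu XY by simp
      also have "\<dots> = ncomp m ?Y \<cdot>\<^bsub>D\<^esub> (u ?Y \<cdot>\<^bsub>D\<^esub> amap (nsrc h) f)"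
        using f u M A XY by simp
      finally show "ncomp m ?Y \<cdot>\<^bsub>D\<^esub> (amap (nsrc m) f \<cdot>\<^bsub>D\<^esub> u ?X) = ncomp m ?Y \<cdot>\<^bsub>D\<^esub> (u ?Y \<cdot>\<^bsub>D\<^esub> amap (nsrc h) f)" .
    qed (use f u M A XY in auto)
  qed (use u in \<open>auto simp: Hom_def\<close>)
  have "m \<cdot>\<^bsub>Fun C D\<^esub> v = h"
    by (rule nattr_eqI[of _ C D]) (use v assms mu in \<open>auto simp: v_def\<close>)
  then show "factors (Fun C D) h m"
    using E.factors_compI[OF assms(4) v] by (simp add: v_def)
qed

text \<open>The hypothesis \<open>fac\<close> says that \<open>amap F f\<close> restricts to the
  chosen subobjects. Monicity makes the restriction \<open>a f\<close> unique, so identities and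
  composites are preserved without any care in the choice.\<close>

lemma subfunctor_ex:
  assumes "category C" "category D" and F: "is_functor C D F"
    and m: "\<And>X. X \<in> Ob C \<Longrightarrow> is_mono D (m X)" "\<And>X. X \<in> Ob C \<Longrightarrow> Cod D (m X) = omap F X"
    and fac: "\<And>f. f \<in> Arr C \<Longrightarrow> factors D (amap F f \<cdot>\<^bsub>D\<^esub> m (Dom C f)) (m (Cod C f))"
  obtains t where "t \<in> Arr (Fun C D)" "ntgt t = F" "\<And>X. X \<in> Ob C \<Longrightarrow> ncomp t X = m X"
proof -
  interpret C: category C by fact
  interpret D: category D by fact
  note Fs = functor_simps[OF F]
  have mA: "m X \<in> Arr D" if "X \<in> Ob C" for X using m(1)[OF that] by (rule is_mono_Arr)
  have "\<forall>f. \<exists>u. f \<in> Arr C \<longrightarrow> u \<in> Arr D \<and> Dom D u = Dom D (m (Dom C f)) \<and> Cod D u = Dom D (m (Cod C f))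
      \<and> m (Cod C f) \<cdot>\<^bsub>D\<^esub> u = amap F f \<cdot>\<^bsub>D\<^esub> m (Dom C f)"
  proof (rule allI)
    fix f
    show "\<exists>u. f \<in> Arr C \<longrightarrow> u \<in> Arr D \<and> Dom D u = Dom D (m (Dom C f)) \<and> Cod D u = Dom D (m (Cod C f))
      \<and> m (Cod C f) \<cdot>\<^bsub>D\<^esub> u = amap F f \<cdot>\<^bsub>D\<^esub> m (Dom C f)"
      using fac[of f] Fs m(2) mA unfolding factors_iff
      by (cases "f \<in> Arr C") auto
  qed
  then obtain a where a: "\<And>f. f \<in> Arr C \<Longrightarrow> a f \<in> Arr D" "\<And>f. f \<in> Arr C \<Longrightarrow> Dom D (a f) = Dom D (m (Dom C f))"
    "\<And>f. f \<in> Arr C \<Longrightarrow> Cod D (a f) = Dom D (m (Cod C f))"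
    and ma: "\<And>f. f \<in> Arr C \<Longrightarrow> m (Cod C f) \<cdot>\<^bsub>D\<^esub> a f = amap F f \<cdot>\<^bsub>D\<^esub> m (Dom C f)"
    by metis
  define G where "G = Functr (\<lambda>X\<in>Ob C. Dom D (m X)) (restrict a (Arr C))"
  have G: "is_functor C D G" unfolding G_def
  proof (rule functorI[OF assms(1)])
    fix X assume X: "X \<in> Ob C"
    have "a (Idt C X) = Idt D (Dom D (m X))"
      by (rule is_mono_cancel[OF m(1)[OF X]])
        (use X a[of "Idt C X"] ma[of "Idt C X"] mA m Fs in auto)
    then show "Dom D (m X) \<in> Ob D \<and> a (Idt C X) = Idt D (Dom D (m X))" using mA[OF X] by simp
  next
    fix f g assume fg: "f \<in> Arr C" "g \<in> Arr C" "Dom C g = Cod C f"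
    have gf: "g \<cdot>\<^bsub>C\<^esub> f \<in> Arr C" "Dom C (g \<cdot>\<^bsub>C\<^esub> f) = Dom C f" "Cod C (g \<cdot>\<^bsub>C\<^esub> f) = Cod C g" using fg by auto
    note mAs = mA[OF C.Dom_in_Ob[OF fg(1)]] mA[OF C.Cod_in_Ob[OF fg(1)]] mA[OF C.Cod_in_Ob[OF fg(2)]]
    note ms = m(2)[OF C.Dom_in_Ob[OF fg(1)]] m(2)[OF C.Cod_in_Ob[OF fg(1)]] m(2)[OF C.Cod_in_Ob[OF fg(2)]]
    have 1: "m (Cod C g) \<cdot>\<^bsub>D\<^esub> a (g \<cdot>\<^bsub>C\<^esub> f) = (amap F g \<cdot>\<^bsub>D\<^esub> amap F f) \<cdot>\<^bsub>D\<^esub> m (Dom C f)"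
      using ma[OF gf(1)] gf fg Fs by simp
    also have "\<dots> = amap F g \<cdot>\<^bsub>D\<^esub> (amap F f \<cdot>\<^bsub>D\<^esub> m (Dom C f))"
      using fg Fs mAs ms by simp
    also have "\<dots> = amap F g \<cdot>\<^bsub>D\<^esub> (m (Cod C f) \<cdot>\<^bsub>D\<^esub> a f)"
      using ma[OF fg(1)] by simp
    also have "\<dots> = (amap F g \<cdot>\<^bsub>D\<^esub> m (Dom C g)) \<cdot>\<^bsub>D\<^esub> a f"
      using fg Fs mAs ms a by simp
    also have "\<dots> = (m (Cod C g) \<cdot>\<^bsub>D\<^esub> a g) \<cdot>\<^bsub>D\<^esub> a f"
      using ma[OF fg(2)] by simp
    also have "\<dots> = m (Cod C g) \<cdot>\<^bsub>D\<^esub> (a g \<cdot>\<^bsub>D\<^esub> a f)"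
      using fg mAs ms a by simp
    finally show "a (g \<cdot>\<^bsub>C\<^esub> f) = a g \<cdot>\<^bsub>D\<^esub> a f"
      by (rule is_mono_cancel[OF m(1)[OF C.Cod_in_Ob[OF fg(2)]], rotated 5])
        (use fg gf a[OF fg(1)] a[OF fg(2)] a[OF gf(1)] in auto)
  qed (use a in \<open>auto simp: Hom_def\<close>)
  have "Nattr G F (restrict m (Ob C)) \<in> Arr (Fun C D)"
    by (rule nattrI[OF assms(1) G F]) (use mA m ma in \<open>auto simp: G_def Hom_def\<close>)
  then show ?thesis by (rule that) auto
qed

section \<open>Kernels of natural transformations\<close>

text \<open>Factoring through \<open>k\<close> and vanishing are both decided on components.\<close>

lemma Fun_kernelI:
  assumes C: "category C" and D: "category_with_zero D" and "f \<in> Arr (Fun C D)" "k \<in> Arr (Fun C D)" "ntgt k = nsrc f"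
    and k: "\<And>X. X \<in> Ob C \<Longrightarrow> is_kernel D (ncomp f X) (ncomp k X)"
  shows "is_kernel (Fun C D) f k"
proof -
  interpret D: category_with_zero D by fact
  interpret E: category_with_zero "Fun C D" by (rule category_with_zero_Fun) fact+
  note K = D.kernel_simps[OF k]
  have "factors (Fun C D) h k = is_zero_arrow (Fun C D) (f \<cdot>\<^bsub>Fun C D\<^esub> h)"
    if h: "h \<in> Arr (Fun C D)" "ntgt h = nsrc f" for h
  proof -
    have "factors (Fun C D) h k \<longleftrightarrow> (\<forall>X\<in>Ob C. factors D (ncomp h X) (ncomp k X))"
      by (rule Fun_factors_iff) (use C D.category_axioms h assms K in auto)
    also have "\<dots> \<longleftrightarrow> (\<forall>X\<in>Ob C. is_zero_arrow D (ncomp (f \<cdot>\<^bsub>Fun C D\<^esub> h) X))"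
      using K(6) h assms(3) by (simp add: nattr_simps)
    also have "\<dots> \<longleftrightarrow> is_zero_arrow (Fun C D) (f \<cdot>\<^bsub>Fun C D\<^esub> h)"
      by (rule Fun_zero_iff[symmetric]) (use C D h assms(3) in auto)
    finally show ?thesis .
  qed
  then show ?thesis
    unfolding E.is_kernel_iff using assms Fun_monoI[OF D.category_axioms assms(4)] K by simp
qed

text \<open>Kernels chosen separately at each object are respected by arrows, since naturality moves
  \<open>f\<close> past \<open>amap (nsrc f) g\<close>; hence they form a subfunctor.\<close>

lemma Fun_kernel_ex:
  assumes C: "category C" and D: "category_with_zero D" and f: "f \<in> Arr (Fun C D)"
    and ker: "\<And>g. g \<in> Arr D \<Longrightarrow> \<exists>k. is_kernel D g k"
  obtains k where "k \<in> Arr (Fun C D)" "ntgt k = nsrc f" "is_kernel (Fun C D) f k"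
    "\<And>X. X \<in> Ob C \<Longrightarrow> is_kernel D (ncomp f X) (ncomp k X)"
proof -
  interpret C: category C by fact
  interpret D: category_with_zero D by fact
  note fs = nattr_simps[OF f]
  note A = functor_simps[OF fs(1)] functor_simps[OF fs(2)]
  define m where "m X = (SOME k. is_kernel D (ncomp f X) k)" for X
  have m: "is_kernel D (ncomp f X) (m X)" if "X \<in> Ob C" for X
    unfolding m_def using ker[OF fs(3)[OF that]] by (rule someI_ex)
  note M = D.kernel_simps[OF m]
  have "factors D (amap (nsrc f) g \<cdot>\<^bsub>D\<^esub> m (Dom C g)) (m (Cod C g))" if g: "g \<in> Arr C" for g
  proof -
    let ?X = "Dom C g" and ?Y = "Cod C g"
    have XY: "?X \<in> Ob C" "?Y \<in> Ob C" using g by auto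
    have "is_zero_arrow D (amap (ntgt f) g \<cdot>\<^bsub>D\<^esub> (ncomp f ?X \<cdot>\<^bsub>D\<^esub> m ?X))"
      by (rule D.zero_arrow_comp_left[OF M(5)]) (use g XY M fs A in auto)
    also have "amap (ntgt f) g \<cdot>\<^bsub>D\<^esub> (ncomp f ?X \<cdot>\<^bsub>D\<^esub> m ?X) = (amap (ntgt f) g \<cdot>\<^bsub>D\<^esub> ncomp f ?X) \<cdot>\<^bsub>D\<^esub> m ?X"
      using g XY M fs A by simp
    also have "\<dots> = (ncomp f ?Y \<cdot>\<^bsub>D\<^esub> amap (nsrc f) g) \<cdot>\<^bsub>D\<^esub> m ?X"
      using naturality[OF f g] by simp
    also have "\<dots> = ncomp f ?Y \<cdot>\<^bsub>D\<^esub> (amap (nsrc f) g \<cdot>\<^bsub>D\<^esub> m ?X)"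
      using g XY M fs A by simp
    finally show ?thesis using g XY M fs A by simp
  qed
  then obtain k where k: "k \<in> Arr (Fun C D)" "ntgt k = nsrc f" "\<And>X. X \<in> Ob C \<Longrightarrow> ncomp k X = m X"
    using subfunctor_ex[OF C D.category_axioms fs(1), of m] M fs by auto
  show ?thesis
    by (rule that[OF k(1,2) Fun_kernelI[OF C D f k(1,2)]]) (use k m in auto)
qed

text \<open>The kernel of a monomorphism of functors vanishes, hence so do the kernels of its components.\<close>

lemma Fun_mono_component:
  assumes C: "category C" and D: "abelian_category D" and m: "is_mono (Fun C D) m" and X: "X \<in> Ob C"
  shows "is_mono D (ncomp m X)"
proof -
  interpret D: abelian_category D by fact
  note Z = C D.category_with_zero_axioms
  interpret E: category_with_zero "Fun C D" by (rule category_with_zero_Fun[OF Z])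
  obtain k where k: "k \<in> Arr (Fun C D)" "ntgt k = nsrc m" "is_kernel (Fun C D) m k"
    "\<And>X. X \<in> Ob C \<Longrightarrow> is_kernel D (ncomp m X) (ncomp k X)"
    using Fun_kernel_ex[OF Z is_mono_Arr[OF m] D.kernels] by blast
  have "is_zero_arrow (Fun C D) k"
    by (rule E.mono_comp_zero[OF m]) (use k E.kernel_simps(5) in auto)
  then show ?thesis
    using D.mono_if_zero_kernel[OF k(4)[OF X]] X Fun_zero_iff[OF Z k(1)] by blast
qed

text \<open>Some kernel of \<open>f\<close> has kernels as components by construction; any other
  kernel is the same subobject, and the equivalence passes to components. This gives access to
  kernels that are chosen by \<open>SOME\<close>.\<close>

lemma Fun_kernel_component:
  assumes C: "category C" and D: "abelian_category D" and k: "is_kernel (Fun C D) f k" and X: "X \<in> Ob C"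
  shows "is_kernel D (ncomp f X) (ncomp k X)"
proof -
  interpret D: abelian_category D by fact
  note Z = C D.category_with_zero_axioms
  interpret E: category_with_zero "Fun C D" by (rule category_with_zero_Fun[OF Z])
  note K = E.kernel_simps[OF k]
  obtain k' where k': "k' \<in> Arr (Fun C D)" "ntgt k' = nsrc f" "is_kernel (Fun C D) f k'"
    "\<And>X. X \<in> Ob C \<Longrightarrow> is_kernel D (ncomp f X) (ncomp k' X)"
    using Fun_kernel_ex[OF Z K(1) D.kernels] by blast
  have mono: "is_mono D (ncomp k Y)" "is_mono D (ncomp k' Y)" if "Y \<in> Ob C" for Y
    using Fun_mono_component[OF C D _ that] K(4) E.kernel_simps(4)[OF k'(3)] by auto
  have "ntgt k = ntgt k'" using K(3) k'(2) by simp
  then have "factors D (ncomp k X) (ncomp k' X)" "factors D (ncomp k' X) (ncomp k X)"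
    using Fun_factors_iff[OF C D.category_axioms, of k k'] Fun_factors_iff[OF C D.category_axioms, of k' k]
      E.kernel_unique[OF k k'(3)] E.kernel_unique[OF k'(3) k] mono X K(2) k'(1) by auto
  then show ?thesis
    using D.kernel_equiv[OF k'(4)[OF X]] mono(1)[OF X] nattr_simps(5)[OF K(2) X] nattr_simps(5)[OF k'(1) X]
      \<open>ntgt k = ntgt k'\<close> by simp
qed

section \<open>Cokernels of natural transformations by duality\<close>

text \<open>A functor between opposite categories consists of the same two maps, whereas a
  transformation changes direction. So \<open>op_nattr\<close> identifies the opposite of
  \<open>Fun C D\<close> with \<open>Fun (op_cat C) (op_cat D)\<close>, and results on kernels
  become results on cokernels.\<close>

definition op_nattr :: "('o, 'a, 'p, 'b) nattr \<Rightarrow> ('o, 'a, 'p, 'b) nattr" where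
  "op_nattr t = Nattr (ntgt t) (nsrc t) (ncomp t)"

lemma op_nattr_simps [simp]:
  "nsrc (op_nattr t) = ntgt t" "ntgt (op_nattr t) = nsrc t" "ncomp (op_nattr t) = ncomp t"
  "op_nattr (op_nattr t) = t"
  by (simp_all add: op_nattr_def)

lemma all_op_nattr: "(\<forall>t. P t) \<longleftrightarrow> (\<forall>t. P (op_nattr t))"
  by (metis op_nattr_simps(4))

lemma ex1_op_nattr: "(\<exists>!t. P t) \<longleftrightarrow> (\<exists>!t. P (op_nattr t))"
  by (metis op_nattr_simps(4))

lemma is_functor_op [simp]: "is_functor (op_cat C) (op_cat D) F \<longleftrightarrow> is_functor C D F"
  by (auto simp: is_functor_def)

lemma op_nattr_Arr [simp]: "op_nattr t \<in> Arr (Fun (op_cat C) (op_cat D)) \<longleftrightarrow> t \<in> Arr (Fun C D)"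
  by (auto simp: is_nattrans_def Fun_def)

lemma op_nattr_Comp [simp]:
  "op_nattr t \<cdot>\<^bsub>Fun (op_cat C) (op_cat D)\<^esub> op_nattr s = op_nattr (s \<cdot>\<^bsub>Fun C D\<^esub> t)"
  by (simp add: Fun_def op_nattr_def)

text \<open>\<open>op_nattr\<close> is an involution, so quantifiers over transformations can be
  reindexed along it, and zero arrows correspond because both sides test them on components. After
  that the two universal properties are the same formula.\<close>

lemma is_kernel_op_nattr:
  assumes "abelian_category C" "abelian_category D"
  shows "is_kernel (Fun (op_cat C) (op_cat D)) (op_nattr t) (op_nattr q) \<longleftrightarrow> is_cokernel (Fun C D) t q"
proof -
  interpret C: abelian_category C by fact
  interpret D: abelian_category D by fact
  interpret C': abelian_category "op_cat C" by (rule C.abelian_category_op_cat)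
  interpret D': abelian_category "op_cat D" by (rule D.abelian_category_op_cat)
  interpret E': category "Fun (op_cat C) (op_cat D)" by (rule category_Fun) unfold_locales
  let ?E' = "Fun (op_cat C) (op_cat D)"
  have zero: "is_zero_arrow ?E' (op_nattr s) \<longleftrightarrow> is_zero_arrow (Fun C D) s" for s
    using Fun_zero_iff[OF C.category_axioms D.category_with_zero_axioms, of s]
      Fun_zero_iff[OF C'.category_axioms D'.category_with_zero_axioms, of "op_nattr s"]
    by (metis is_zero_arrow_Arr is_zero_arrow_op_cat op_cat_simps(1) op_nattr_Arr op_nattr_simps(3))
  have inj: "op_nattr s = op_nattr s' \<longleftrightarrow> s = s'" for s s' :: "('a, 'b, 'c, 'd) nattr"
    by (metis op_nattr_simps(4))
  show ?thesis
    unfolding is_cokernel_def is_kernel_def Ball_def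
    by (subst (1) all_op_nattr, subst (1) ex1_op_nattr) (simp add: Hom_def zero inj)
qed

lemma Fun_cokernel_ex:
  assumes C: "abelian_category C" and D: "abelian_category D" and t: "t \<in> Arr (Fun C D)"
  shows "\<exists>q. is_cokernel (Fun C D) t q"
proof -
  interpret C': abelian_category "op_cat C" using C by (rule abelian_category.abelian_category_op_cat)
  interpret D': abelian_category "op_cat D" using D by (rule abelian_category.abelian_category_op_cat)
  obtain k where "is_kernel (Fun (op_cat C) (op_cat D)) (op_nattr t) k"
    using Fun_kernel_ex[OF C'.category_axioms D'.category_with_zero_axioms _ D'.kernels, of "op_nattr t"] t by auto
  then have "is_cokernel (Fun C D) t (op_nattr k)"
    using is_kernel_op_nattr[OF C D, of t "op_nattr k"] by simp
  then show ?thesis by blast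
qed

lemma Fun_cokernel_component:
  assumes C: "abelian_category C" and D: "abelian_category D" and q: "is_cokernel (Fun C D) t q" and X: "X \<in> Ob C"
  shows "is_cokernel D (ncomp t X) (ncomp q X)"
proof -
  interpret C': abelian_category "op_cat C" using C by (rule abelian_category.abelian_category_op_cat)
  have "is_kernel (op_cat D) (ncomp (op_nattr t) X) (ncomp (op_nattr q) X)"
    by (rule Fun_kernel_component[of "op_cat C"])
      (use C'.category_axioms abelian_category.abelian_category_op_cat[OF D] is_kernel_op_nattr[OF C D] q X in auto)
  then show ?thesis by (simp add: is_cokernel_def)
qed

section \<open>Subobjects\<close>

lemma sub_rel_iff:
  "(m, n) \<in> sub_rel C X \<longleftrightarrow> m \<in> monos_into C X \<and> n \<in> monos_into C X \<and> factors C m n \<and> factors C n m"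
  by (simp add: sub_rel_def)

context category
begin

lemma equiv_sub_rel: "equiv (monos_into C X) (sub_rel C X)"
proof (rule equivI)
  show "sub_rel C X \<subseteq> monos_into C X \<times> monos_into C X" by (auto simp: sub_rel_def)
  show "refl_on (monos_into C X) (sub_rel C X)"
    by (auto simp: refl_on_def sub_rel_def monos_into_def intro: factors_refl is_mono_Arr)
  show "sym (sub_rel C X)" by (auto simp: sym_def sub_rel_def)
  show "trans (sub_rel C X)"
    by (rule transI) (auto simp: sub_rel_def monos_into_def intro: factors_trans is_mono_Arr)
qed

lemma sub_class_in: "m \<in> monos_into C X \<Longrightarrow> sub_class C X m \<in> subobjects C X"
  by (simp add: sub_class_def subobjects_def quotientI)

lemma subobjectsE:
  assumes "A \<in> subobjects C X"
  obtains m where "m \<in> monos_into C X" "A = sub_class C X m"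
  using assms by (auto simp: subobjects_def sub_class_def elim: quotientE)

lemma sub_class_eq_iff:
  assumes "m \<in> monos_into C X" "n \<in> monos_into C X"
  shows "sub_class C X m = sub_class C X n \<longleftrightarrow> factors C m n \<and> factors C n m"
  using eq_equiv_class_iff[OF equiv_sub_rel assms] assms by (simp add: sub_class_def sub_rel_iff)

lemma sub_class_le_iff:
  assumes "m \<in> monos_into C X" "n \<in> monos_into C X"
  shows "sub_class C X m \<sqsubseteq>\<^bsub>subobject_order C X\<^esub> sub_class C X n \<longleftrightarrow> factors C m n"
proof -
  have "factors C m n" if "(m, m') \<in> sub_rel C X" "(n, n') \<in> sub_rel C X" "factors C m' n'" for m' n'
    using that assms unfolding sub_rel_iff monos_into_def
    by (metis factors_trans is_mono_Arr mem_Collect_eq)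
  moreover have "(m, m) \<in> sub_rel C X" "(n, n) \<in> sub_rel C X"
    using assms by (auto simp: sub_rel_iff monos_into_def intro: factors_refl is_mono_Arr)
  ultimately show ?thesis
    by (auto simp: subobject_order_def sub_class_def)
qed

text \<open>\<open>inf\<close> is a choice among the greatest lower bounds, so the class of
  \<open>r\<close> has to be the only one; this holds because subobjects below each other are equal
  as classes. The index collection \<open>I\<close> may have any size.\<close>

lemma sub_class_inf_eq:
  assumes w: "\<And>i. i \<in> I \<Longrightarrow> w i \<in> monos_into C X" and r: "r \<in> monos_into C X"
    and glb: "\<And>m. m \<in> monos_into C X \<Longrightarrow> factors C m r \<longleftrightarrow> (\<forall>i\<in>I. factors C m (w i))"
  shows "\<Sqinter>\<^bsub>subobject_order C X\<^esub> ((\<lambda>i. sub_class C X (w i)) ` I) = sub_class C X r"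
proof -
  let ?L = "subobject_order C X" and ?A = "(\<lambda>i. sub_class C X (w i)) ` I"
  have car: "carrier ?L = subobjects C X" by (simp add: subobject_order_def)
  have lower: "sub_class C X m \<in> Lower ?L ?A \<longleftrightarrow> factors C m r" if m: "m \<in> monos_into C X" for m
    using sub_class_in w m glb[OF m] sub_class_le_iff[OF m w] by (auto simp: Lower_def car)
  have "factors C r r" using r by (auto simp: monos_into_def intro: factors_refl is_mono_Arr)
  have gr: "greatest ?L (sub_class C X r) (Lower ?L ?A)"
    unfolding greatest_def
  proof (intro conjI ballI)
    show "Lower ?L ?A \<subseteq> carrier ?L" by (auto simp: Lower_def)
    show "sub_class C X r \<in> Lower ?L ?A" using lower[OF r] \<open>factors C r r\<close> by simp
    fix B assume B: "B \<in> Lower ?L ?A"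
    then obtain m where "m \<in> monos_into C X" "B = sub_class C X m"
      by (auto simp: Lower_def car elim: subobjectsE)
    then show "B \<sqsubseteq>\<^bsub>?L\<^esub> sub_class C X r" using B lower sub_class_le_iff r by simp
  qed
  have "B = sub_class C X r" if B: "greatest ?L B (Lower ?L ?A)" for B
  proof -
    have "B \<in> subobjects C X" using B by (auto simp: greatest_def Lower_def car)
    then obtain m where m: "m \<in> monos_into C X" "B = sub_class C X m" by (rule subobjectsE)
    have "sub_class C X r \<sqsubseteq>\<^bsub>?L\<^esub> B" "B \<sqsubseteq>\<^bsub>?L\<^esub> sub_class C X r"
      using greatest_le[OF B] greatest_le[OF gr] B gr by (simp_all add: greatest_def)
    then show ?thesis using m r sub_class_le_iff sub_class_eq_iff by simp
  qed
  with gr show ?thesis unfolding Lattice.inf_def by (rule some_equality)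
qed

end

section \<open>Preradicals\<close>

text \<open>A preradical whiskered with \<open>S\<close> ends in
  \<open>comp_functor C (id_functor C) S\<close>, whereas the pullback needs its codomain to be
  literally \<open>S\<close>. Extensionality of functors makes this an equation.\<close>

lemma comp_functor_id:
  assumes "is_functor B C F"
  shows "comp_functor B (id_functor C) F = F"
proof (rule functr.expand, intro conjI)
  note F = functor_simps[OF assms]
  show "omap (comp_functor B (id_functor C) F) = omap F"
    by (rule extensionalityI[of _ "Ob B"])
      (use assms F in \<open>auto simp: is_functor_def comp_functor_def id_functor_def compose_def\<close>)
  show "amap (comp_functor B (id_functor C) F) = amap F"
    by (rule extensionalityI[of _ "Arr B"])
      (use assms F in \<open>auto simp: is_functor_def comp_functor_def id_functor_def compose_def\<close>)
qed

context abelian_category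
begin

interpretation End: category_with_zero "End C"
  by (rule category_with_zero_Fun) unfold_locales

lemma preradical_simps:
  assumes "t \<in> monos_into (End C) (id_functor C)"
  shows "t \<in> Arr (End C)" "is_mono (End C) t" "ntgt t = id_functor C"
    "X \<in> Ob C \<Longrightarrow> is_mono C (ncomp t X)" "X \<in> Ob C \<Longrightarrow> ncomp t X \<in> Arr C"
    "X \<in> Ob C \<Longrightarrow> Dom C (ncomp t X) = omap (nsrc t) X" "X \<in> Ob C \<Longrightarrow> Cod C (ncomp t X) = X"
    "is_functor C C (nsrc t)"
proof -
  show t: "t \<in> Arr (End C)" "is_mono (End C) t" "ntgt t = id_functor C"
    using assms by (auto simp: monos_into_def is_mono_Arr)
  note T = nattr_simps[OF t(1)]
  show "X \<in> Ob C \<Longrightarrow> is_mono C (ncomp t X)"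
    by (rule Fun_mono_component[OF category_axioms abelian_category_axioms t(2)])
  show "X \<in> Ob C \<Longrightarrow> ncomp t X \<in> Arr C" "X \<in> Ob C \<Longrightarrow> Dom C (ncomp t X) = omap (nsrc t) X"
    "X \<in> Ob C \<Longrightarrow> Cod C (ncomp t X) = X" "is_functor C C (nsrc t)"
    using T t by simp_all
qed

lemma preradical_naturality:
  assumes "t \<in> monos_into (End C) (id_functor C)" "f \<in> Arr C" "Dom C f = X" "Cod C f = Y"
  shows "f \<cdot> ncomp t X = ncomp t Y \<cdot> amap (nsrc t) f"
  using naturality[OF preradical_simps(1)[OF assms(1)] assms(2-)] preradical_simps(3)[OF assms(1)] assms(2) by simp

text \<open>By naturality the composite passes through \<open>ncomp t Y\<close>. In this way
  vanishing at one object constrains a preradical at every object that maps there.\<close>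

lemma preradical_comp_zero:
  assumes t: "t \<in> monos_into (End C) (id_functor C)" and f: "f \<in> Arr C" "Dom C f = X" "Cod C f = Y"
    and z: "is_zero_arrow C (ncomp t Y)"
  shows "is_zero_arrow C (f \<cdot> ncomp t X)"
  unfolding preradical_naturality[OF t f]
  by (rule zero_arrow_comp_right[OF z])
    (use f preradical_simps[OF t] functor_simps[OF preradical_simps(8)[OF t]] Cod_in_Ob[OF f(1)] in auto)

lemma preradical_factors_iff:
  assumes s: "s \<in> monos_into (End C) (id_functor C)" and t: "t \<in> monos_into (End C) (id_functor C)"
  shows "factors (End C) s t \<longleftrightarrow> (\<forall>X\<in>Ob C. factors C (ncomp s X) (ncomp t X))"
  by (rule Fun_factors_iff[OF category_axioms category_axioms])
    (use preradical_simps[OF s] preradical_simps[OF t] in auto)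

section \<open>Meets of preradicals given by vanishing conditions\<close>

text \<open>
  For each object \<open>L\<close> it suffices to consider one arrow out of \<open>L\<close> for each subobject of \<open>L\<close> that
  is the kernel of an arrow into \<open>F\<close>; this makes the family of arrows small.
\<close>

lemma common_kernel_ex:
  assumes cpl: "complete TYPE('u) C" and sub: "locally_small TYPE('u) C" and L: "L \<in> Ob C"
  shows "\<exists>m. is_mono C m \<and> Cod C m = L \<and> (\<forall>h\<in>Arr C. Cod C h = L \<longrightarrow>
     (factors C h m \<longleftrightarrow> (\<forall>f\<in>Arr C. Dom C f = L \<longrightarrow> Cod C f \<in> F \<longrightarrow> is_zero_arrow C (f \<cdot> h))))"
proof -
  define good where "good A f \<longleftrightarrow> f \<in> Arr C \<and> Dom C f = L \<and> Cod C f \<in> F \<and> (\<exists>k\<in>A. is_kernel C f k)" for A f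
  define I where "I = {A \<in> subobjects C L. \<exists>f. good A f}"
  define g where "g A = (SOME f. good A f)" for A
  have g: "good A (g A)" if "A \<in> I" for A
    using that unfolding I_def g_def by (auto intro: someI_ex)
  then have gA: "g A \<in> Arr C" "Dom C (g A) = L" "Cod C (g A) \<in> F" if "A \<in> I" for A
    using that by (auto simp: good_def)
  have "small TYPE('u) I"
    using sub L small_subset[of "TYPE('u)" "subobjects C L" I] by (auto simp: locally_small_def I_def)
  then obtain P p where P: "is_product C I (\<lambda>A. Cod C (g A)) P p"
    using complete_product_ex[OF cpl _ _ category_axioms, of I "\<lambda>A. Cod C (g A)"] gA by auto
  have "\<exists>!u. u \<in> Hom C L P \<and> (\<forall>A\<in>I. p A \<cdot> u = g A)"
    by (rule is_product_lift[OF P L]) (use gA in \<open>auto simp: Hom_def\<close>)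
  then obtain u where u: "u \<in> Arr C" "Dom C u = L" "Cod C u = P" "\<And>A. A \<in> I \<Longrightarrow> p A \<cdot> u = g A"
    by (auto simp: Hom_def)
  obtain m where m: "is_kernel C u m" using kernels[OF u(1)] by blast
  note M = kernel_simps[OF m]
  have "factors C h m \<longleftrightarrow> (\<forall>f\<in>Arr C. Dom C f = L \<longrightarrow> Cod C f \<in> F \<longrightarrow> is_zero_arrow C (f \<cdot> h))"
    if h: "h \<in> Arr C" "Cod C h = L" for h
  proof -
    have "factors C h m \<longleftrightarrow> is_zero_arrow C (u \<cdot> h)" using M h u by simp
    also have "\<dots> \<longleftrightarrow> (\<forall>A\<in>I. is_zero_arrow C (p A \<cdot> (u \<cdot> h)))"
      by (rule is_product_zero_iff[OF P]) (use h u in auto)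
    also have "\<dots> \<longleftrightarrow> (\<forall>A\<in>I. is_zero_arrow C (g A \<cdot> h))"
    proof (rule ball_cong[OF refl])
      fix A assume A: "A \<in> I"
      have "p A \<cdot> (u \<cdot> h) = (p A \<cdot> u) \<cdot> h"
        using A h u(1-3) is_product_Arr[OF P] by simp
      then show "is_zero_arrow C (p A \<cdot> (u \<cdot> h)) \<longleftrightarrow> is_zero_arrow C (g A \<cdot> h)"
        using u(4)[OF A] by simp
    qed
    also have "\<dots> \<longleftrightarrow> (\<forall>f\<in>Arr C. Dom C f = L \<longrightarrow> Cod C f \<in> F \<longrightarrow> is_zero_arrow C (f \<cdot> h))"
    proof (intro iffI ballI impI)
      fix f assume z: "\<forall>A\<in>I. is_zero_arrow C (g A \<cdot> h)" and f: "f \<in> Arr C" "Dom C f = L" "Cod C f \<in> F"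
      obtain k where k: "is_kernel C f k" using kernels[OF f(1)] by blast
      note K = kernel_simps[OF k]
      have kL: "k \<in> monos_into C L" using K f by (simp add: monos_into_def)
      \<comment> \<open>The arrow chosen for the class of \<open>k\<close> need not be
        \<open>f\<close>, but its kernel is the same subobject, so it kills \<open>h\<close> iff
        \<open>f\<close> does.\<close>
      let ?A = "sub_class C L k"
      have "k \<in> ?A" using kL factors_refl[OF K(2)] by (simp add: sub_class_def sub_rel_iff)
      then have A: "?A \<in> I" using sub_class_in[OF kL] f k by (auto simp: I_def good_def)
      then obtain k' where k': "k' \<in> ?A" "is_kernel C (g ?A) k'" using g by (auto simp: good_def)
      then have "factors C k' k" by (simp add: sub_class_def sub_rel_iff)
      moreover have "factors C h k'"
        using kernel_simps(6)[OF k'(2)] z A gA[OF A] h by simp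
      ultimately have "factors C h k" using factors_trans K(2) by blast
      then show "is_zero_arrow C (f \<cdot> h)" using K(6)[of h] h f by simp
    qed (use gA in auto)
    finally show ?thesis .
  qed
  then show ?thesis using M(3,4) u(2) by blast
qed

text \<open>At \<open>L\<close> the preradical \<open>r\<close> is the common kernel of all arrows
  from \<open>L\<close> into objects of \<open>F\<close>. These arrows are stable under
  precomposition, which makes \<open>r\<close> a subfunctor. A preradical \<open>s\<close> is killed
  by all of them as soon as it vanishes on \<open>F\<close>, by naturality; the converse is the case
  of identity arrows.\<close>

lemma preradical_meet_ex:
  assumes cpl: "complete TYPE('u) C" and sub: "locally_small TYPE('u) C" and F: "F \<subseteq> Ob C"
  obtains r where "r \<in> monos_into (End C) (id_functor C)"
    "\<And>s. s \<in> monos_into (End C) (id_functor C) \<Longrightarrow>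
       factors (End C) s r \<longleftrightarrow> (\<forall>M\<in>F. is_zero_arrow C (ncomp s M))"
proof -
  define good where "good L m \<longleftrightarrow> is_mono C m \<and> Cod C m = L \<and> (\<forall>h\<in>Arr C. Cod C h = L \<longrightarrow>
     (factors C h m \<longleftrightarrow> (\<forall>f\<in>Arr C. Dom C f = L \<longrightarrow> Cod C f \<in> F \<longrightarrow> is_zero_arrow C (f \<cdot> h))))" for L m
  define m where "m L = (SOME k. good L k)" for L
  have "good L (m L)" if L: "L \<in> Ob C" for L
    unfolding m_def by (rule someI_ex) (simp only: good_def common_kernel_ex[OF cpl sub L])
  then have m: "is_mono C (m L)" "Cod C (m L) = L" and
    fac: "\<And>h. h \<in> Arr C \<Longrightarrow> Cod C h = L \<Longrightarrow> factors C h (m L) \<longleftrightarrow>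
      (\<forall>f\<in>Arr C. Dom C f = L \<longrightarrow> Cod C f \<in> F \<longrightarrow> is_zero_arrow C (f \<cdot> h))" if "L \<in> Ob C" for L
    using that unfolding good_def by blast+
  have mA: "m L \<in> Arr C" if "L \<in> Ob C" for L using m(1)[OF that] by (rule is_mono_Arr)
  have nat: "factors C (amap (id_functor C) g \<cdot> m (Dom C g)) (m (Cod C g))" if g: "g \<in> Arr C" for g
  proof -
    have XY: "Dom C g \<in> Ob C" "Cod C g \<in> Ob C" using g by auto
    have "is_zero_arrow C (f \<cdot> (g \<cdot> m (Dom C g)))" if f: "f \<in> Arr C" "Dom C f = Cod C g" "Cod C f \<in> F" for f
    proof -
      have "is_zero_arrow C ((f \<cdot> g) \<cdot> m (Dom C g))"
        using fac[OF XY(1) mA[OF XY(1)] m(2)[OF XY(1)]] factors_refl[OF mA[OF XY(1)]] f g by simp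
      then show ?thesis using f g mA[OF XY(1)] m(2)[OF XY(1)] by simp
    qed
    then show ?thesis using fac[OF XY(2), of "g \<cdot> m (Dom C g)"] g mA[OF XY(1)] m(2)[OF XY(1)] by simp
  qed
  obtain r where r: "r \<in> Arr (End C)" "ntgt r = id_functor C" "\<And>X. X \<in> Ob C \<Longrightarrow> ncomp r X = m X"
    using subfunctor_ex[OF category_axioms category_axioms is_functor_id, of m] m nat by auto
  have rP: "r \<in> monos_into (End C) (id_functor C)"
    using Fun_monoI[OF category_axioms r(1)] m r by (simp add: monos_into_def)
  moreover have "factors (End C) s r \<longleftrightarrow> (\<forall>M\<in>F. is_zero_arrow C (ncomp s M))"
    if s: "s \<in> monos_into (End C) (id_functor C)" for s
  proof -
    note S = preradical_simps[OF s]
    have "factors (End C) s r \<longleftrightarrow> (\<forall>X\<in>Ob C. \<forall>f\<in>Arr C. Dom C f = X \<longrightarrow> Cod C f \<in> F \<longrightarrow> is_zero_arrow C (f \<cdot> ncomp s X))"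
      unfolding preradical_factors_iff[OF s rP] using r(3) fac S by simp
    also have "\<dots> \<longleftrightarrow> (\<forall>M\<in>F. is_zero_arrow C (ncomp s M))"
    proof (intro iffI ballI impI)
      fix M assume *: "\<forall>X\<in>Ob C. \<forall>f\<in>Arr C. Dom C f = X \<longrightarrow> Cod C f \<in> F \<longrightarrow> is_zero_arrow C (f \<cdot> ncomp s X)"
        and M: "M \<in> F"
      have "M \<in> Ob C" using M F by blast
      then show "is_zero_arrow C (ncomp s M)"
        using *[rule_format, of M "Idt C M"] M S by simp
    qed (use preradical_comp_zero[OF s] in auto)
    finally show ?thesis .
  qed
  ultimately show ?thesis by (rule that)
qed

section \<open>Omega preradicals\<close>

lemma pow_map_simps:
  assumes I: "is_product C I (\<lambda>_. M) (pow_ob C M I) (pow_proj C M I)"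
    and J: "is_product C J (\<lambda>_. M) (pow_ob C M J) (pow_proj C M J)" and \<phi>: "\<And>i. i \<in> I \<Longrightarrow> \<phi> i \<in> J"
  shows "pow_map C M I J \<phi> \<in> Arr C" "Dom C (pow_map C M I J \<phi>) = pow_ob C M J"
    "Cod C (pow_map C M I J \<phi>) = pow_ob C M I"
    "i \<in> I \<Longrightarrow> pow_proj C M I i \<cdot> pow_map C M I J \<phi> = pow_proj C M J (\<phi> i)"
proof -
  have "\<exists>!h. h \<in> Hom C (pow_ob C M J) (pow_ob C M I) \<and> (\<forall>i\<in>I. pow_proj C M I i \<cdot> h = pow_proj C M J (\<phi> i))"
    by (rule is_product_lift[OF I]) (use is_product_Arr[OF J] \<phi> in \<open>auto simp: Hom_def\<close>)
  from theI'[OF this, folded pow_map_def] show "pow_map C M I J \<phi> \<in> Arr C"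
    "Dom C (pow_map C M I J \<phi>) = pow_ob C M J" "Cod C (pow_map C M I J \<phi>) = pow_ob C M I"
    "i \<in> I \<Longrightarrow> pow_proj C M I i \<cdot> pow_map C M I J \<phi> = pow_proj C M J (\<phi> i)"
    by (auto simp: Hom_def)
qed

text \<open>Arrows into a power are compared on projections, where \<open>pow_map\<close> becomes
  precomposition of the index; functoriality is then the unit and associative law of
  \<open>C\<close>.\<close>

lemma W_functor:
  assumes P: "\<And>L. L \<in> Ob C \<Longrightarrow>
    is_product C (Hom C L N) (\<lambda>_. M) (pow_ob C M (Hom C L N)) (pow_proj C M (Hom C L N))"
  shows "is_functor C C (W_functor C N M)"
  unfolding W_functor_def
proof (rule functorI[OF category_axioms])
  let ?P = "\<lambda>L. pow_ob C M (Hom C L N)" and ?p = "\<lambda>L. pow_proj C M (Hom C L N)"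
  let ?a = "\<lambda>g. pow_map C M (Hom C (Cod C g) N) (Hom C (Dom C g) N) (\<lambda>f. f \<cdot> g)"
  have a: "?a g \<in> Arr C" "Dom C (?a g) = ?P (Dom C g)" "Cod C (?a g) = ?P (Cod C g)"
    "\<And>f. f \<in> Hom C (Cod C g) N \<Longrightarrow> ?p (Cod C g) f \<cdot> ?a g = ?p (Dom C g) (f \<cdot> g)" if g: "g \<in> Arr C" for g
    by (rule pow_map_simps[OF P[OF Cod_in_Ob[OF g]] P[OF Dom_in_Ob[OF g]]]; use g in \<open>auto simp: Hom_def\<close>)+
  note p = is_product_Arr[OF P]
  show "?a g \<in> Hom C (?P (Dom C g)) (?P (Cod C g))" if "g \<in> Arr C" for g
    using a(1-3)[OF that] by (simp add: Hom_def)
  show "?P L \<in> Ob C \<and> ?a (Idt C L) = Idt C (?P L)" if L: "L \<in> Ob C" for L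
  proof -
    have "?a (Idt C L) = Idt C (?P L)"
    proof (rule is_product_eqI[OF P[OF L]])
      fix f assume f: "f \<in> Hom C L N"
      then show "?p L f \<cdot> ?a (Idt C L) = ?p L f \<cdot> Idt C (?P L)"
        using a(4)[of "Idt C L" f] L p[OF L] by (simp add: Hom_def)
    qed (use a(1-3)[of "Idt C L"] L p[OF L] in auto)
    then show ?thesis using p(1)[OF L] by simp
  qed
  fix g h assume g: "g \<in> Arr C" and h: "h \<in> Arr C" and gh: "Dom C h = Cod C g"
  have hg: "h \<cdot> g \<in> Arr C" "Dom C (h \<cdot> g) = Dom C g" "Cod C (h \<cdot> g) = Cod C h" using g h gh by auto
  show "?a (h \<cdot> g) = ?a h \<cdot> ?a g"
  proof (rule is_product_eqI[OF P[OF Cod_in_Ob[OF h]]])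
    fix f assume f: "f \<in> Hom C (Cod C h) N"
    then have fA: "f \<in> Arr C" "Dom C f = Cod C h" "Cod C f = N" by (auto simp: Hom_def)
    have fh: "f \<cdot> h \<in> Hom C (Cod C g) N" using fA h gh by (simp add: Hom_def)
    note ph = p(2-4)[OF Cod_in_Ob[OF h] f]
    have "?p (Cod C h) f \<cdot> (?a h \<cdot> ?a g) = (?p (Cod C h) f \<cdot> ?a h) \<cdot> ?a g"
      using a(1-3)[OF g] a(1-3)[OF h] ph gh by simp
    also have "\<dots> = ?p (Cod C g) (f \<cdot> h) \<cdot> ?a g" using a(4)[OF h f] gh by simp
    also have "\<dots> = ?p (Dom C g) ((f \<cdot> h) \<cdot> g)" using a(4)[OF g fh] by simp
    also have "\<dots> = ?p (Dom C g) (f \<cdot> (h \<cdot> g))" using fA g h gh by simp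
    also have "\<dots> = ?p (Cod C h) f \<cdot> ?a (h \<cdot> g)" using a(4)[OF hg(1), of f] hg(2,3) f by simp
    finally show "?p (Cod C h) f \<cdot> ?a (h \<cdot> g) = ?p (Cod C h) f \<cdot> (?a h \<cdot> ?a g)" by simp
  qed (use a(1-3)[OF g] a(1-3)[OF h] a(1-3)[OF hg(1)] hg gh in auto)
qed

text \<open>Naturality is checked on projections: at index \<open>f\<close> both ways around the
  square give \<open>k \<cdot> f \<cdot> g\<close>.\<close>

lemma W_nat_simps:
  assumes k: "k \<in> Arr C" and P: "\<And>L. L \<in> Ob C \<Longrightarrow>
    is_product C (Hom C L (Dom C k)) (\<lambda>_. Cod C k) (pow_ob C (Cod C k) (Hom C L (Dom C k)))
      (pow_proj C (Cod C k) (Hom C L (Dom C k)))"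
  shows "W_nat C k \<in> Arr (End C)" "nsrc (W_nat C k) = id_functor C"
    "L \<in> Ob C \<Longrightarrow> Cod C (ncomp (W_nat C k) L) = pow_ob C (Cod C k) (Hom C L (Dom C k))"
    "\<lbrakk>L \<in> Ob C; f \<in> Hom C L (Dom C k)\<rbrakk> \<Longrightarrow>
      pow_proj C (Cod C k) (Hom C L (Dom C k)) f \<cdot> ncomp (W_nat C k) L = k \<cdot> f"
proof -
  let ?N = "Dom C k" and ?M = "Cod C k"
  let ?P = "\<lambda>L. pow_ob C ?M (Hom C L ?N)" and ?p = "\<lambda>L. pow_proj C ?M (Hom C L ?N)"
  let ?W = "W_functor C ?N ?M"
  define w where "w L = (THE h. h \<in> Hom C L (?P L) \<and> (\<forall>f\<in>Hom C L ?N. ?p L f \<cdot> h = k \<cdot> f))" for L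
  have wH: "w L \<in> Hom C L (?P L) \<and> (\<forall>f\<in>Hom C L ?N. ?p L f \<cdot> w L = k \<cdot> f)" if L: "L \<in> Ob C" for L
  proof -
    have "\<exists>!h. h \<in> Hom C L (?P L) \<and> (\<forall>f\<in>Hom C L ?N. ?p L f \<cdot> h = k \<cdot> f)"
      by (rule is_product_lift[OF P[OF L] L]) (use k in \<open>auto simp: Hom_def\<close>)
    then show ?thesis unfolding w_def by (rule theI')
  qed
  have w: "w L \<in> Arr C" "Dom C (w L) = L" "Cod C (w L) = ?P L"
    "\<And>f. f \<in> Hom C L ?N \<Longrightarrow> ?p L f \<cdot> w L = k \<cdot> f" if "L \<in> Ob C" for L
    using wH[OF that] by (auto simp: Hom_def)
  have W: "W_nat C k = Nattr (id_functor C) ?W (restrict w (Ob C))"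
    by (simp add: W_nat_def w_def[abs_def])
  have F: "is_functor C C ?W" by (rule W_functor[OF P])
  note Fs = functor_simps[OF F]
  have oW: "omap ?W L = ?P L" if "L \<in> Ob C" for L using that by (simp add: W_functor_def)
  show "W_nat C k \<in> Arr (End C)" unfolding W
  proof (rule nattrI[OF category_axioms is_functor_id F])
    show "w X \<in> Hom C (omap (id_functor C) X) (omap ?W X)" if "X \<in> Ob C" for X
      using wH[OF that] that oW by simp
    fix g assume g: "g \<in> Arr C"
    let ?X = "Dom C g" and ?Y = "Cod C g"
    have XY: "?X \<in> Ob C" "?Y \<in> Ob C" using g by auto
    note wX = w[OF XY(1)] and wY = w[OF XY(2)]
    have aW: "amap ?W g = pow_map C ?M (Hom C ?Y ?N) (Hom C ?X ?N) (\<lambda>f. f \<cdot> g)"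
      using g by (simp add: W_functor_def)
    show "amap ?W g \<cdot> w ?X = w ?Y \<cdot> amap (id_functor C) g"
    proof (rule is_product_eqI[OF P[OF XY(2)]])
      fix f assume f: "f \<in> Hom C ?Y ?N"
      then have fA: "f \<in> Arr C" "Dom C f = ?Y" "Cod C f = ?N" by (auto simp: Hom_def)
      have fg: "f \<cdot> g \<in> Hom C ?X ?N" using fA g by (simp add: Hom_def)
      note p = is_product_Arr(2-4)[OF P[OF XY(2)] f]
      have "?p ?Y f \<cdot> (amap ?W g \<cdot> w ?X) = (?p ?Y f \<cdot> amap ?W g) \<cdot> w ?X"
        using p wX(1-3) Fs(3-5)[OF g] oW XY by simp
      also have "?p ?Y f \<cdot> amap ?W g = ?p ?X (f \<cdot> g)"
        unfolding aW by (rule pow_map_simps(4)[OF P[OF XY(2)] P[OF XY(1)] _ f]) (use g in \<open>auto simp: Hom_def\<close>)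
      also have "?p ?X (f \<cdot> g) \<cdot> w ?X = (k \<cdot> f) \<cdot> g" using wX(4)[OF fg] fA g k by simp
      also have "\<dots> = (?p ?Y f \<cdot> w ?Y) \<cdot> g" using wY(4)[OF f] by simp
      also have "\<dots> = ?p ?Y f \<cdot> (w ?Y \<cdot> g)" using p wY(1-3) g by simp
      finally show "?p ?Y f \<cdot> (amap ?W g \<cdot> w ?X) = ?p ?Y f \<cdot> (w ?Y \<cdot> amap (id_functor C) g)" using g by simp
    qed (use g wX(1-3) wY(1-3) Fs(3-5)[OF g] oW XY in auto)
  qed
  show "nsrc (W_nat C k) = id_functor C" by (simp add: W)
  show "L \<in> Ob C \<Longrightarrow> Cod C (ncomp (W_nat C k) L) = ?P L"
    "\<lbrakk>L \<in> Ob C; f \<in> Hom C L ?N\<rbrakk> \<Longrightarrow> ?p L f \<cdot> ncomp (W_nat C k) L = k \<cdot> f"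
    using w by (simp_all add: W)
qed

text \<open>As \<open>omega C k\<close> is the kernel of \<open>W_nat C k\<close>, \<open>s\<close>
  lies below it iff \<open>k \<cdot> f\<close> kills \<open>ncomp s L\<close> for all
  \<open>f\<close> from \<open>L\<close> to \<open>Dom C k\<close>. Naturality of \<open>s\<close>
  reduces this to the single case where \<open>f\<close> is the identity of
  \<open>Dom C k\<close>.\<close>

lemma omega_preradical:
  assumes cpl: "complete TYPE('u) C" and hs: "hom_small TYPE('u) C" and k: "k \<in> Arr C"
  shows "omega C k \<in> monos_into (End C) (id_functor C)"
    and "s \<in> monos_into (End C) (id_functor C) \<Longrightarrow>
      factors (End C) s (omega C k) \<longleftrightarrow> is_zero_arrow C (k \<cdot> ncomp s (Dom C k))"
proof -
  let ?N = "Dom C k" and ?M = "Cod C k"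
  let ?p = "\<lambda>L. pow_proj C ?M (Hom C L ?N)"
  have NM: "?N \<in> Ob C" "?M \<in> Ob C" using k by auto
  have P: "is_product C (Hom C L ?N) (\<lambda>_. ?M) (pow_ob C ?M (Hom C L ?N)) (?p L)" if L: "L \<in> Ob C" for L
  proof -
    \<comment> \<open>The powers are indexed by Hom-sets, whose smallness puts them within reach of
      completeness; only then is the choice in \<open>pow\<close> a product.\<close>
    have "small TYPE('u) (Hom C L ?N)" using hs L NM by (auto simp: hom_small_def)
    then have "\<exists>P p. is_product C (Hom C L ?N) (\<lambda>_. ?M) P p"
      using complete_product_ex[OF cpl _ _ category_axioms, of "Hom C L ?N" "\<lambda>_. ?M"] NM by blast
    then have "\<exists>P. is_product C (Hom C L ?N) (\<lambda>_. ?M) (fst P) (snd P)" by simp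
    then show ?thesis unfolding pow_def by (rule someI_ex)
  qed
  have W: "W_nat C k \<in> Arr (End C)" "nsrc (W_nat C k) = id_functor C"
    "\<And>L. L \<in> Ob C \<Longrightarrow> Cod C (ncomp (W_nat C k) L) = pow_ob C ?M (Hom C L ?N)"
    "\<And>L f. \<lbrakk>L \<in> Ob C; f \<in> Hom C L ?N\<rbrakk> \<Longrightarrow> ?p L f \<cdot> ncomp (W_nat C k) L = k \<cdot> f"
    by (rule W_nat_simps[OF k P]; assumption)+
  note Ws = nattr_simps[OF W(1)]
  have "\<exists>w. is_kernel (End C) (W_nat C k) w"
    using Fun_kernel_ex[OF category_axioms category_with_zero_axioms W(1) kernels] by metis
  then have ker: "is_kernel (End C) (W_nat C k) (omega C k)" unfolding omega_def by (rule someI_ex)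
  note K = End.kernel_simps[OF ker]
  show "omega C k \<in> monos_into (End C) (id_functor C)"
    using K W(2) by (simp add: monos_into_def)
  assume s: "s \<in> monos_into (End C) (id_functor C)"
  note S = preradical_simps[OF s]
  have eq: "?p L f \<cdot> (ncomp (W_nat C k) L \<cdot> ncomp s L) = k \<cdot> (f \<cdot> ncomp s L)"
    if L: "L \<in> Ob C" and f: "f \<in> Hom C L ?N" for L f
  proof -
    note p = is_product_Arr(2-4)[OF P[OF L] f]
    have fA: "f \<in> Arr C" "Dom C f = L" "Cod C f = ?N" using f by (auto simp: Hom_def)
    have "?p L f \<cdot> (ncomp (W_nat C k) L \<cdot> ncomp s L) = (?p L f \<cdot> ncomp (W_nat C k) L) \<cdot> ncomp s L"
      using L p S W(2,3) Ws by simp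
    also have "\<dots> = (k \<cdot> f) \<cdot> ncomp s L" using W(4)[OF L f] by simp
    also have "\<dots> = k \<cdot> (f \<cdot> ncomp s L)" using fA k S L by simp
    finally show ?thesis .
  qed
  have "factors (End C) s (omega C k) \<longleftrightarrow> is_zero_arrow (End C) (W_nat C k \<cdot>\<^bsub>End C\<^esub> s)"
    using K S W by simp
  also have "\<dots> \<longleftrightarrow> (\<forall>L\<in>Ob C. is_zero_arrow C (ncomp (W_nat C k) L \<cdot> ncomp s L))"
    using Fun_zero_iff[OF category_axioms category_with_zero_axioms, of "W_nat C k \<cdot>\<^bsub>End C\<^esub> s"] S W by simp
  also have "\<dots> \<longleftrightarrow> (\<forall>L\<in>Ob C. \<forall>f\<in>Hom C L ?N. is_zero_arrow C (k \<cdot> (f \<cdot> ncomp s L)))"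
  proof (rule ball_cong[OF refl])
    fix L assume L: "L \<in> Ob C"
    have "is_zero_arrow C (ncomp (W_nat C k) L \<cdot> ncomp s L) \<longleftrightarrow>
      (\<forall>f\<in>Hom C L ?N. is_zero_arrow C (?p L f \<cdot> (ncomp (W_nat C k) L \<cdot> ncomp s L)))"
      by (rule is_product_zero_iff[OF P[OF L]]) (use L S W Ws in auto)
    then show "is_zero_arrow C (ncomp (W_nat C k) L \<cdot> ncomp s L) \<longleftrightarrow>
      (\<forall>f\<in>Hom C L ?N. is_zero_arrow C (k \<cdot> (f \<cdot> ncomp s L)))"
      using eq[OF L] by simp
  qed
  also have "\<dots> \<longleftrightarrow> is_zero_arrow C (k \<cdot> ncomp s ?N)"
  proof (intro iffI ballI)
    assume "\<forall>L\<in>Ob C. \<forall>f\<in>Hom C L ?N. is_zero_arrow C (k \<cdot> (f \<cdot> ncomp s L))"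
    then have "is_zero_arrow C (k \<cdot> (Idt C ?N \<cdot> ncomp s ?N))" using NM Idt_Hom by blast
    then show "is_zero_arrow C (k \<cdot> ncomp s ?N)" using S NM by simp
  next
    fix L f assume z: "is_zero_arrow C (k \<cdot> ncomp s ?N)" and L: "L \<in> Ob C" and "f \<in> Hom C L ?N"
    then have f: "f \<in> Arr C" "Dom C f = L" "Cod C f = ?N" by (auto simp: Hom_def)
    note A = functor_simps[OF S(8)]
    have "is_zero_arrow C ((k \<cdot> ncomp s ?N) \<cdot> amap (nsrc s) f)"
      by (rule zero_arrow_comp_right[OF z]) (use A(3-5)[OF f(1)] f k S NM in auto)
    also have "(k \<cdot> ncomp s ?N) \<cdot> amap (nsrc s) f = k \<cdot> (ncomp s ?N \<cdot> amap (nsrc s) f)"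
      using A(3-5)[OF f(1)] f k S NM by simp
    finally show "is_zero_arrow C (k \<cdot> (f \<cdot> ncomp s L))" using preradical_naturality[OF s f] by simp
  qed
  finally show "factors (End C) s (omega C k) \<longleftrightarrow> is_zero_arrow C (k \<cdot> ncomp s ?N)" .
qed

section \<open>Coproducts of preradicals, and radicals\<close>

lemma is_cokernel_coker_pr:
  assumes "t \<in> monos_into (End C) (id_functor C)"
  shows "is_cokernel (End C) t (coker_pr C t)"
  unfolding coker_pr_def
  using Fun_cokernel_ex[OF abelian_category_axioms abelian_category_axioms preradical_simps(1)[OF assms]]
  by (rule someI_ex)

text \<open>The whiskered monomorphism is the kernel of its cokernel \<open>c\<close>, so pulling it
  back along \<open>q\<close> means taking the kernel of \<open>c \<cdot> q\<close>. As that kernel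
  exists, so does the pullback, and the choice in \<open>coprod_pr\<close> has both
  descriptions.\<close>

lemma is_pullback_coprod_pr:
  assumes s: "s \<in> monos_into (End C) (id_functor C)" and t: "t \<in> monos_into (End C) (id_functor C)"
  defines "q \<equiv> coker_pr C s"
  obtains c y where "is_cokernel (End C) (whisker C t (ntgt q)) c"
    "is_kernel (End C) (c \<cdot>\<^bsub>End C\<^esub> q) (coprod_pr C s t)"
    "is_pullback (End C) q (whisker C t (ntgt q)) (coprod_pr C s t) y"
proof -
  let ?w = "whisker C t (ntgt q)"
  note T = preradical_simps[OF t]
  note Z = category_axioms category_with_zero_axioms
  note AA = abelian_category_axioms abelian_category_axioms
  have q: "is_cokernel (End C) s q" unfolding q_def by (rule is_cokernel_coker_pr[OF s])
  note Q = End.cokernel_simps[OF q]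
  have qF: "is_functor C C (ntgt q)" using nattr_simps(2)[OF Q(2)] .
  have w: "?w \<in> Arr (End C)" by (rule whisker_Arr[OF category_axioms qF T(1)])
  have wt: "ntgt ?w = ntgt q" using T(3) comp_functor_id[OF qF] by simp
  obtain c where c: "is_cokernel (End C) ?w c" using Fun_cokernel_ex[OF AA w] by blast
  note Cs = End.cokernel_simps[OF c]
  \<comment> \<open>That monomorphisms are kernels is an axiom for \<open>C\<close> only, so this is
    proved on components.\<close>
  have "is_kernel (End C) c ?w"
  proof (rule Fun_kernelI[OF Z])
    show "is_kernel C (ncomp c X) (ncomp ?w X)" if X: "X \<in> Ob C" for X
    proof (rule mono_kernel_of_cokernel)
      show "is_mono C (ncomp ?w X)" using X T(4)[of "omap (ntgt q) X"] functor_simps(1)[OF qF] by simp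
      show "is_cokernel C (ncomp ?w X) (ncomp c X)" by (rule Fun_cokernel_component[OF AA c X])
    qed
  qed (use Cs w in auto)
  then have iff: "is_kernel (End C) (c \<cdot>\<^bsub>End C\<^esub> q) p \<longleftrightarrow> (\<exists>y. is_pullback (End C) q ?w p y)" for p
    by (rule End.kernel_comp_iff_pullback) (use Q Cs wt in auto)
  have "c \<cdot>\<^bsub>End C\<^esub> q \<in> Arr (End C)" using Q Cs wt by simp
  then obtain p where "is_kernel (End C) (c \<cdot>\<^bsub>End C\<^esub> q) p"
    using Fun_kernel_ex[OF Z _ kernels] by metis
  then have "\<exists>p y. is_pullback (End C) q ?w p y" using iff by blast
  then have "\<exists>y. is_pullback (End C) q ?w (coprod_pr C s t) y"
    unfolding coprod_pr_def q_def by (rule someI_ex)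
  then show ?thesis using that[OF c] iff by blast
qed

text \<open>Being a kernel, \<open>coprod_pr C s t\<close> is monic; it contains \<open>s\<close>
  because \<open>coker_pr C s\<close> already kills \<open>s\<close>.\<close>

lemma coprod_pr_preradical:
  assumes s: "s \<in> monos_into (End C) (id_functor C)" and t: "t \<in> monos_into (End C) (id_functor C)"
  shows "coprod_pr C s t \<in> monos_into (End C) (id_functor C)" "factors (End C) s (coprod_pr C s t)"
proof -
  let ?q = "coker_pr C s"
  obtain c where c: "is_cokernel (End C) (whisker C t (ntgt ?q)) c"
    "is_kernel (End C) (c \<cdot>\<^bsub>End C\<^esub> ?q) (coprod_pr C s t)"
    using is_pullback_coprod_pr[OF s t] by blast
  note S = preradical_simps[OF s]
  note Q = End.cokernel_simps[OF is_cokernel_coker_pr[OF s]] and Cs = End.cokernel_simps[OF c(1)] and P = End.kernel_simps[OF c(2)]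
  have qs: "nsrc ?q = id_functor C" using Q S by simp
  have cq: "nsrc c = ntgt ?q"
    using Cs preradical_simps(3)[OF t] comp_functor_id[OF nattr_simps(2)[OF Q(2)]] by simp
  show "coprod_pr C s t \<in> monos_into (End C) (id_functor C)"
    using P qs by (simp add: monos_into_def)
  have "is_zero_arrow (End C) (c \<cdot>\<^bsub>End C\<^esub> (?q \<cdot>\<^bsub>End C\<^esub> s))"
    by (rule End.zero_arrow_comp_left[OF Q(5)]) (use Cs cq in auto)
  also have "c \<cdot>\<^bsub>End C\<^esub> (?q \<cdot>\<^bsub>End C\<^esub> s) = (c \<cdot>\<^bsub>End C\<^esub> ?q) \<cdot>\<^bsub>End C\<^esub> s"
    by (rule End.Comp_Comp[symmetric]) (use S Q Cs cq qs in auto)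
  finally show "factors (End C) s (coprod_pr C s t)"
    using P(6)[OF S(1)] S qs by simp
qed

text \<open>\<open>t\<close> lies below \<open>(t : t)\<close> in any case, so only the other
  inequality is a condition.\<close>

lemma radical_iff:
  assumes t: "t \<in> monos_into (End C) (id_functor C)"
  shows "radical C t \<longleftrightarrow> factors (End C) (coprod_pr C t t) t"
  unfolding radical_def pr_class_def
  using End.sub_class_eq_iff[OF coprod_pr_preradical(1)[OF t t] t] coprod_pr_preradical(2)[OF t t] by simp

text \<open>
  With \<open>q\<close> the cokernel of \<open>t\<close> and \<open>c\<close> that of \<open>t\<close> at the quotient, \<open>c \<cdot> q\<close> and \<open>q\<close> are
  cokernels of the same subobject, so \<open>c\<close> is invertible.
\<close>

lemma radical_quotient_torsion_free:
  assumes t: "t \<in> monos_into (End C) (id_functor C)" and rad: "radical C t" and X: "X \<in> Ob C"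
  shows "is_zero_arrow C (ncomp t (omap (ntgt (coker_pr C t)) X))"
proof -
  let ?q = "coker_pr C t" and ?p = "coprod_pr C t t"
  let ?w = "whisker C t (ntgt ?q)"
  obtain c where c: "is_cokernel (End C) ?w c" "is_kernel (End C) (c \<cdot>\<^bsub>End C\<^esub> ?q) ?p"
    using is_pullback_coprod_pr[OF t t] by blast
  note AA = abelian_category_axioms abelian_category_axioms
  note P = preradical_simps[OF coprod_pr_preradical(1)[OF t t]] and T = preradical_simps[OF t]
  define qX cX pX tX where "qX = ncomp ?q X" and "cX = ncomp c X" and "pX = ncomp ?p X" and "tX = ncomp t X"
  have q: "is_cokernel C tX qX"
    using Fun_cokernel_component[OF AA is_cokernel_coker_pr[OF t] X] by (simp add: tX_def qX_def)
  have w: "is_cokernel C (ncomp t (omap (ntgt ?q) X)) cX"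
    using Fun_cokernel_component[OF AA c(1) X] X by (simp add: cX_def)
  have p: "is_kernel C (cX \<cdot> qX) pX"
    using Fun_kernel_component[OF category_axioms abelian_category_axioms c(2) X] X by (simp add: cX_def qX_def pX_def)
  note Q = cokernel_simps[OF q] and W = cokernel_simps[OF w]
  have qF: "omap (ntgt ?q) X \<in> Ob C"
    using functor_simps(1)[OF nattr_simps(2)[OF End.cokernel_simps(2)[OF is_cokernel_coker_pr[OF t]]] X] .
  have qc: "Cod C qX = omap (ntgt ?q) X"
    using nattr_simps(5)[OF End.cokernel_simps(2)[OF is_cokernel_coker_pr[OF t]] X] by (simp add: qX_def)
  have cd: "Dom C cX = Cod C qX" using W(3) T(7)[OF qF] qc by simp
  \<comment> \<open>For a radical, \<open>(t : t)\<close> and \<open>t\<close> are the same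
    subobject, so \<open>tX\<close> is also a kernel of the epimorphism
    \<open>cX \<cdot> qX\<close>, which makes the latter a cokernel of \<open>tX\<close>.\<close>
  have "factors C pX tX" "factors C tX pX"
    using rad radical_iff[OF t] coprod_pr_preradical[OF t t] preradical_factors_iff t X
    by (auto simp: pX_def tX_def)
  then have "is_kernel C (cX \<cdot> qX) tX"
    using kernel_equiv[OF p] T X P by (simp add: tX_def pX_def)
  moreover have "is_epi C (cX \<cdot> qX)" by (rule is_epi_comp[OF Q(4) W(4) cd])
  ultimately have cq: "is_cokernel C tX (cX \<cdot> qX)" by (intro epi_cokernel_of_kernel)
  \<comment> \<open>\<open>qX\<close> kills \<open>tX\<close> and hence extends along
    \<open>cX \<cdot> qX\<close>; cancelling the epimorphism \<open>qX\<close> shows that the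
    extension \<open>d\<close> is a left inverse of \<open>cX\<close>.\<close>
  have "factors (op_cat C) qX (cX \<cdot> qX)"
    using cokernel_simps(6)[OF cq Q(2,3)] Q(5) by simp
  then obtain d where d: "d \<in> Arr C" "Dom C d = Cod C cX" "Cod C d = Cod C qX" "d \<cdot> (cX \<cdot> qX) = qX"
    using Q(2) W(2) cd by (auto simp: factors_op_iff)
  have "d \<cdot> cX = Idt C (Cod C qX)"
    by (rule is_epi_cancel[OF Q(4)]) (use d Q(2) W(2) cd in auto)
  \<comment> \<open>\<open>cX\<close> kills \<open>t\<close> at the quotient, and applying
    \<open>d\<close> recovers \<open>t\<close> there.\<close>
  then have "ncomp t (omap (ntgt ?q) X) = (d \<cdot> cX) \<cdot> ncomp t (omap (ntgt ?q) X)"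
    using W(1) T(7)[OF qF] qc by simp
  also have "\<dots> = d \<cdot> (cX \<cdot> ncomp t (omap (ntgt ?q) X))"
    by (rule Comp_Comp) (use d(1,2) W(1-3) in auto)
  finally have eq: "ncomp t (omap (ntgt ?q) X) = d \<cdot> (cX \<cdot> ncomp t (omap (ntgt ?q) X))" .
  have "is_zero_arrow C (d \<cdot> (cX \<cdot> ncomp t (omap (ntgt ?q) X)))"
    by (rule zero_arrow_comp_left[OF W(5)]) (use d(1,2) W(1-3) in auto)
  then show ?thesis unfolding eq[symmetric] .
qed

lemma factors_radical:
  assumes t: "t \<in> monos_into (End C) (id_functor C)" and rad: "radical C t"
    and r: "r \<in> monos_into (End C) (id_functor C)" and rF: "\<And>M. M \<in> \<F> C t \<Longrightarrow> is_zero_arrow C (ncomp r M)"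
  shows "factors (End C) r t"
  unfolding preradical_factors_iff[OF r t]
proof
  fix X assume X: "X \<in> Ob C"
  let ?q = "coker_pr C t"
  note R = preradical_simps[OF r] and T = preradical_simps[OF t]
  note Q = End.cokernel_simps[OF is_cokernel_coker_pr[OF t]]
  have q: "is_cokernel C (ncomp t X) (ncomp ?q X)"
    by (rule Fun_cokernel_component[OF abelian_category_axioms abelian_category_axioms is_cokernel_coker_pr[OF t] X])
  note qX = cokernel_simps[OF q]
  have Y: "Cod C (ncomp ?q X) = omap (ntgt ?q) X" using nattr_simps(5)[OF Q(2) X] .
  have "omap (ntgt ?q) X \<in> \<F> C t"
    using radical_quotient_torsion_free[OF t rad X] functor_simps(1)[OF nattr_simps(2)[OF Q(2)] X]
    by (simp add: torsion_free_def)
  then have "is_zero_arrow C (ncomp ?q X \<cdot> ncomp r X)"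
    using preradical_comp_zero[OF r qX(2) _ Y rF, of X] qX(3) T(7)[OF X] by simp
  then show "factors C (ncomp r X) (ncomp t X)"
    using kernel_simps(6)[OF mono_kernel_of_cokernel[OF T(4)[OF X] q], of "ncomp r X"] R X qX(3) T(7)[OF X] by simp
qed

text \<open>If \<open>t\<close> vanishes at \<open>M\<close>, then the quotient of \<open>M\<close> by \<open>t\<close> is \<open>M\<close> itself.\<close>

lemma coprod_pr_torsion_free:
  assumes t: "t \<in> monos_into (End C) (id_functor C)" and M: "M \<in> \<F> C t"
  shows "is_zero_arrow C (ncomp (coprod_pr C t t) M)"
proof -
  let ?q = "coker_pr C t" and ?p = "coprod_pr C t t"
  have MO: "M \<in> Ob C" and z: "is_zero_arrow C (ncomp t M)" using M by (auto simp: torsion_free_def)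
  obtain y where y: "is_pullback (End C) ?q (whisker C t (ntgt ?q)) ?p y" using is_pullback_coprod_pr[OF t t] by blast
  note T = preradical_simps[OF t] and P = preradical_simps[OF coprod_pr_preradical(1)[OF t t]]
  note Q = End.cokernel_simps[OF is_cokernel_coker_pr[OF t]]
  note qF = functor_simps[OF nattr_simps(2)[OF Q(2)]]
  let ?N = "omap (ntgt ?q) M"
  have NO: "?N \<in> Ob C" by (rule qF(1)[OF MO])
  have yA: "y \<in> Arr (End C)" "ntgt y = nsrc (whisker C t (ntgt ?q))"
    and sq: "?q \<cdot>\<^bsub>End C\<^esub> ?p = whisker C t (ntgt ?q) \<cdot>\<^bsub>End C\<^esub> y"
    using y by (auto simp: is_pullback_def)
  have sqM: "ncomp ?q M \<cdot> ncomp ?p M = ncomp t ?N \<cdot> ncomp y M"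
    using arg_cong[OF sq, of "\<lambda>s. ncomp s M"] MO by simp
  have q: "is_cokernel C (ncomp t M) (ncomp ?q M)"
    by (rule Fun_cokernel_component[OF abelian_category_axioms abelian_category_axioms is_cokernel_coker_pr[OF t] MO])
  note qM = cokernel_simps[OF q]
  have qD: "Dom C (ncomp ?q M) = M" "Cod C (ncomp ?q M) = ?N"
    using qM(3) T(7)[OF MO] nattr_simps(5)[OF Q(2) MO] by auto
  \<comment> \<open>Since \<open>t\<close> vanishes at \<open>M\<close>, the identity of
    \<open>M\<close> extends along the cokernel of \<open>ncomp t M\<close>, which gives a left
    inverse \<open>d\<close> of the projection.\<close>
  have "is_zero_arrow C (Idt C M \<cdot> ncomp t M)" using z T MO by simp
  then have "factors (op_cat C) (Idt C M) (ncomp ?q M)"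
    using qM(6)[of "Idt C M"] T MO by simp
  then obtain d where d: "d \<in> Arr C" "Dom C d = ?N" "Cod C d = M" "d \<cdot> ncomp ?q M = Idt C M"
    using MO qD by (auto simp: factors_op_iff)
  have yM: "ncomp y M \<in> Arr C" "Cod C (ncomp y M) = omap (nsrc t) ?N"
    using nattr_simps[OF yA(1)] yA(2) MO by auto
  \<comment> \<open>\<open>d\<close> maps into \<open>M\<close>, where \<open>t\<close> vanishes, so
    it kills \<open>ncomp t ?N\<close>. By the pullback square \<open>d\<close> then also kills
    \<open>ncomp ?q M \<cdot> ncomp ?p M\<close>, and \<open>d\<close> applied to that composite is
    \<open>ncomp ?p M\<close>.\<close>
  have "is_zero_arrow C ((d \<cdot> ncomp t ?N) \<cdot> ncomp y M)"
    by (rule zero_arrow_comp_right[OF preradical_comp_zero[OF t d(1-3) z] yM(1)])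
      (use T NO d(1-3) yM in auto)
  also have "(d \<cdot> ncomp t ?N) \<cdot> ncomp y M = d \<cdot> (ncomp ?q M \<cdot> ncomp ?p M)"
    unfolding sqM by (rule Comp_Comp) (use T NO d(1-3) yM in auto)
  also have "\<dots> = (d \<cdot> ncomp ?q M) \<cdot> ncomp ?p M"
    by (rule Comp_Comp[symmetric]) (use P MO d(1-3) qM(2) qD in auto)
  also have "\<dots> = ncomp ?p M" using d(4) P MO by simp
  finally show ?thesis .
qed

end

theorem proposition7p15:
  fixes C :: "('o, 'a) cat" and t :: "('o, 'a, 'o, 'a) nattr"
  assumes "universe TYPE('u)"
    and "abelian_category C"
    and "hom_small TYPE('u) C"
    and "bicomplete TYPE('u) C"
    and "locally_small TYPE('u) C"
    and "t \<in> monos_into (End C) (id_functor C)"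
  shows "radical C t \<longleftrightarrow>
    pr_class C t = \<Sqinter>\<^bsub>Pr C\<^esub> ((\<lambda>M. pr_class C (omega C (Idt C M))) ` \<F> C t)"
proof -
  interpret abelian_category C by fact
  interpret End: category "End C" by (rule category_Fun) unfold_locales
  note t = assms(6)
  have cpl: "complete TYPE('u) C" using assms(4) by (simp add: bicomplete_def)
  have F: "\<F> C t \<subseteq> Ob C" by (auto simp: torsion_free_def)
  obtain r where r: "r \<in> monos_into (End C) (id_functor C)"
    and fac: "\<And>s. s \<in> monos_into (End C) (id_functor C) \<Longrightarrow>
       factors (End C) s r \<longleftrightarrow> (\<forall>M\<in>\<F> C t. is_zero_arrow C (ncomp s M))"
    using preradical_meet_ex[OF cpl assms(5) F] by metis
  have "\<Sqinter>\<^bsub>Pr C\<^esub> ((\<lambda>M. pr_class C (omega C (Idt C M))) ` \<F> C t) = pr_class C r"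
    unfolding Pr_def pr_class_def
  proof (rule End.sub_class_inf_eq[OF _ r])
    fix M assume "M \<in> \<F> C t"
    then show "omega C (Idt C M) \<in> monos_into (End C) (id_functor C)"
      using omega_preradical(1)[OF cpl assms(3)] F by auto
  next
    fix s assume s: "s \<in> monos_into (End C) (id_functor C)"
    have "factors (End C) s (omega C (Idt C M)) \<longleftrightarrow> is_zero_arrow C (ncomp s M)" if "M \<in> \<F> C t" for M
      using omega_preradical(2)[OF cpl assms(3) _ s, of "Idt C M"] preradical_simps[OF s] that F by auto
    then show "factors (End C) s r \<longleftrightarrow> (\<forall>M\<in>\<F> C t. factors (End C) s (omega C (Idt C M)))"
      using fac[OF s] by simp
  qed
  moreover have "pr_class C t = pr_class C r \<longleftrightarrow> factors (End C) r t"
  proof -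
    \<comment> \<open>\<open>t\<close> vanishes on \<open>\<F> C t\<close> by definition of that
      class, so equality with \<open>r\<close> needs only the opposite factorization.\<close>
    have "factors (End C) t r" using fac[OF t] by (simp add: torsion_free_def)
    then show ?thesis unfolding pr_class_def using End.sub_class_eq_iff[OF t r] by simp
  qed
  moreover have "radical C t \<longleftrightarrow> factors (End C) r t"
  proof
    assume "radical C t"
    \<comment> \<open>The property that characterizes \<open>r\<close> is applied to
      \<open>r\<close> itself, which factors through itself.\<close>
    moreover have "\<forall>M\<in>\<F> C t. is_zero_arrow C (ncomp r M)"
      using fac[OF r] r End.factors_refl preradical_simps(1) by blast
    ultimately show "factors (End C) r t" using factors_radical[OF t _ r] by blast
  next
    assume rt: "factors (End C) r t"
    have "factors (End C) (coprod_pr C t t) r"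
      using fac coprod_pr_preradical(1)[OF t t] coprod_pr_torsion_free[OF t] by blast
    then show "radical C t"
      using radical_iff[OF t] End.factors_trans rt preradical_simps(1)[OF t] by blast
  qed
  ultimately show ?thesis by simp
qed

end
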